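(* For any reals $A$ and $B$, $A$ and $B$ are both in $\mathcal{KT}(\Delta^0_2)$ if and only if $A\oplus B\in\mathcal{KT}(\Delta^0_2)$.
   Context: Reals are elements of $2^{\omega}$ (infinite binary sequences); $A\upharpoonright n$ is the initial segment of $A$ of length $n$. $K(\sigma)$ is the prefix-free Kolmogorov complexity of the finite binary string $\sigma$ with respect to a fixed universal prefix-free machine, and for $n \in \omega$, $K(n)$ denotes the complexity of the string of $n$ zeros. An order is a function $g:\omega\to\omega$ that is nondecreasing and unbounded (not necessarily recursive). For $g:\omega\to\omega$, $\mathcal{KT}(g)$ is the set of reals $A$ for which there is a constant $c$ such that for all $n\in\omega$, $K(A\upharpoonright n)\leq K(n)+g(n)+c$. $\mathcal{KT}(\Delta^0_2)$ is the intersection of $\mathcal{KT}(g)$ over all $\Delta^0_2$ orders $g$. The effective join $A\oplus B$ is the real given by $(A\oplus B)(2n)=A(n)$ and $(A\oplus B)(2n+1)=B(n)$. *)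

theory Defs
  imports Main "HOL-Library.Nat_Bijection" "HOL-Library.Sublist"
begin

text \<open>Partial recursive functions are taken to be unary on the natural numbers; several arguments
  are passed through the pairing function \<^const>\<open>prod_encode\<close>.\<close>

primrec prim_iter ::
  "(nat \<Rightarrow> nat option) \<Rightarrow> (nat \<Rightarrow> nat option) \<Rightarrow> nat \<Rightarrow> nat \<Rightarrow> nat option" where
  "prim_iter f g a 0 = f a"
| "prim_iter f g a (Suc y) =
     Option.bind (prim_iter f g a y) (\<lambda>i. g (prod_encode (a, prod_encode (y, i))))"

text \<open>Unbounded search: the search diverges if some value below the first zero is undefined.\<close>

definition mu_search :: "(nat \<Rightarrow> nat option) \<Rightarrow> nat option" where
  "mu_search h =
     (if \<exists>n. h n = Some 0 \<and> (\<forall>m<n. h m \<noteq> None)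
      then Some (LEAST n. h n = Some 0) else None)"

inductive partial_recursive :: "(nat \<Rightarrow> nat option) \<Rightarrow> bool" where
  zero: "partial_recursive (\<lambda>_. Some 0)"
| succ: "partial_recursive (\<lambda>n. Some (Suc n))"
| left: "partial_recursive (\<lambda>n. Some (fst (prod_decode n)))"
| right: "partial_recursive (\<lambda>n. Some (snd (prod_decode n)))"
| pair: "partial_recursive f \<Longrightarrow> partial_recursive g \<Longrightarrow>
    partial_recursive
      (\<lambda>n. Option.bind (f n) (\<lambda>x. Option.bind (g n) (\<lambda>y. Some (prod_encode (x, y)))))"
| comp: "partial_recursive f \<Longrightarrow> partial_recursive g \<Longrightarrow>
    partial_recursive (\<lambda>n. Option.bind (g n) f)"
| prim_rec: "partial_recursive f \<Longrightarrow> partial_recursive g \<Longrightarrow>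
    partial_recursive (\<lambda>n. prim_iter f g (fst (prod_decode n)) (snd (prod_decode n)))"
| search: "partial_recursive f \<Longrightarrow>
    partial_recursive (\<lambda>a. mu_search (\<lambda>n. f (prod_encode (a, n))))"

definition recursive_set :: "nat set \<Rightarrow> bool" where
  "recursive_set X \<longleftrightarrow> partial_recursive (\<lambda>n. Some (if n \<in> X then 1 else 0))"

definition Sigma02_set :: "nat set \<Rightarrow> bool" where
  "Sigma02_set X \<longleftrightarrow>
     (\<exists>R. recursive_set R \<and>
        (\<forall>n. n \<in> X \<longleftrightarrow> (\<exists>x. \<forall>y. prod_encode (n, prod_encode (x, y)) \<in> R)))"

definition Pi02_set :: "nat set \<Rightarrow> bool" where
  "Pi02_set X \<longleftrightarrow>
     (\<exists>R. recursive_set R \<and>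
        (\<forall>n. n \<in> X \<longleftrightarrow> (\<forall>x. \<exists>y. prod_encode (n, prod_encode (x, y)) \<in> R)))"

definition Delta02_set :: "nat set \<Rightarrow> bool" where
  "Delta02_set X \<longleftrightarrow> Sigma02_set X \<and> Pi02_set X"

text \<open>A total function is \<open>\<Delta>\<^sup>0\<^sub>2\<close> iff its graph is.\<close>

definition Delta02_fun :: "(nat \<Rightarrow> nat) \<Rightarrow> bool" where
  "Delta02_fun g \<longleftrightarrow> Delta02_set (range (\<lambda>n. prod_encode (n, g n)))"

type_synonym machine = "bool list \<Rightarrow> bool list option"

definition string_code :: "bool list \<Rightarrow> nat" where
  "string_code \<sigma> = list_encode (map of_bool \<sigma>)"

text \<open>The values of \<open>\<phi>\<close> at numbers that are not string codes are irrelevant, because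
  the set of string codes is recursive.\<close>

definition recursive_machine :: "machine \<Rightarrow> bool" where
  "recursive_machine M \<longleftrightarrow>
     (\<exists>\<phi>. partial_recursive \<phi> \<and>
        (\<forall>\<sigma>. \<phi> (string_code \<sigma>) = map_option string_code (M \<sigma>)))"

definition prefix_free_machine :: "machine \<Rightarrow> bool" where
  "prefix_free_machine M \<longleftrightarrow>
     recursive_machine M \<and>
     (\<forall>\<sigma>\<in>dom M. \<forall>\<tau>\<in>dom M. prefix \<sigma> \<tau> \<longrightarrow> \<sigma> = \<tau>)"

definition universal_prefix_free_machine :: "machine \<Rightarrow> bool" where
  "universal_prefix_free_machine U \<longleftrightarrow>
     prefix_free_machine U \<and>
     (\<forall>M. prefix_free_machine M \<longrightarrow> (\<exists>\<rho>. \<forall>\<sigma>. U (\<rho> @ \<sigma>) = M \<sigma>))"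

text \<open>Meaningful for universal \<open>U\<close>, where every string has a description.\<close>

definition K :: "machine \<Rightarrow> bool list \<Rightarrow> nat" where
  "K U \<sigma> = (LEAST l. \<exists>\<tau>. length \<tau> = l \<and> U \<tau> = Some \<sigma>)"

definition K_nat :: "machine \<Rightarrow> nat \<Rightarrow> nat" where
  "K_nat U n = K U (replicate n False)"

type_synonym cantor_real = "nat \<Rightarrow> bool"

definition initial_segment :: "cantor_real \<Rightarrow> nat \<Rightarrow> bool list" where
  "initial_segment A n = map A [0..<n]"

definition order_fun :: "(nat \<Rightarrow> nat) \<Rightarrow> bool" where
  "order_fun g \<longleftrightarrow> mono g \<and> (\<forall>b. \<exists>n. b < g n)"

definition KT :: "machine \<Rightarrow> (nat \<Rightarrow> nat) \<Rightarrow> cantor_real set" where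
  "KT U g = {A. \<exists>c. \<forall>n. K U (initial_segment A n) \<le> K_nat U n + g n + c}"

definition KT_Delta02 :: "machine \<Rightarrow> cantor_real set" where
  "KT_Delta02 U = (\<Inter>g\<in>{g. order_fun g \<and> Delta02_fun g}. KT U g)"

definition effective_join :: "cantor_real \<Rightarrow> cantor_real \<Rightarrow> cantor_real" where
  "effective_join A B n = (if even n then A (n div 2) else B (n div 2))"

end

theory Submission imports Defs Complex_Main
begin

text \<open>Let \<open>Q n\<close> be the probability that \<open>U\<close> outputs some string of length \<open>n\<close>, and \<open>Q t n\<close> its
  approximation at stage \<open>t\<close>. Kraft-Chaitin gives the coding theorem: \<open>Q n\<close> is \<open>1 / 2 ^ K n\<close> up to a
  constant factor. Suppose \<open>\<sigma>\<close> and \<open>\<tau>\<close> have length \<open>n\<close> and complexity at most \<open>K n + d\<close>. Whenever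
  \<open>1 / 2 ^ k \<le> Q t n < 2 / 2 ^ k\<close>, at most \<open>2 ^ (d + 1)\<close> strings of length \<open>n\<close> have at stage \<open>t\<close> a
  description of length at most \<open>k + d\<close>, so one can afford to request, for each pair of them, a
  description of length \<open>k + 3 d + 4\<close> of the interleaved string: summing over \<open>d\<close> and the levels \<open>k\<close>, the
  total weight for \<open>n\<close> is at most \<open>Q n\<close>. Hence \<open>A, B \<in> KT g\<close> implies \<open>A \<oplus> B \<in> KT (3 g)\<close>, and for an
  order \<open>h\<close> one takes \<open>g = h div 3\<close>. Conversely \<open>K (A \<restriction> n)\<close> is at most the complexity of
  \<open>A \<oplus> B\<close> up to \<open>2 n\<close>, so one takes \<open>g n = h (n div 2)\<close>.\<close>

section \<open>Total recursive functions\<close>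

definition total_recursive :: "(nat \<Rightarrow> nat) \<Rightarrow> bool" where
  "total_recursive f \<longleftrightarrow> partial_recursive (\<lambda>n. Some (f n))"

abbreviation pfst :: "nat \<Rightarrow> nat" where "pfst z \<equiv> fst (prod_decode z)"
abbreviation psnd :: "nat \<Rightarrow> nat" where "psnd z \<equiv> snd (prod_decode z)"

lemma partial_recursive_total_comp:
  "partial_recursive f \<Longrightarrow> total_recursive g \<Longrightarrow> partial_recursive (\<lambda>n. f (g n))"
  unfolding total_recursive_def
  by (drule (1) partial_recursive.comp) simp

lemma total_recursive_comp:
  "total_recursive f \<Longrightarrow> total_recursive g \<Longrightarrow> total_recursive (\<lambda>n. f (g n))"
  using partial_recursive_total_comp[of "\<lambda>n. Some (f n)" g] by (simp add: total_recursive_def)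

lemma total_recursive_pfst0: "total_recursive pfst"
  and total_recursive_psnd0: "total_recursive psnd"
  unfolding total_recursive_def by (rule partial_recursive.intros)+

lemma total_recursive_pair:
  assumes "total_recursive f" "total_recursive g"
  shows "total_recursive (\<lambda>n. prod_encode (f n, g n))"
  using partial_recursive.pair[of "\<lambda>n. Some (f n)" "\<lambda>n. Some (g n)"] assms
  by (simp add: total_recursive_def)

lemma total_recursive_id: "total_recursive (\<lambda>n. n)"
  using total_recursive_pair[OF total_recursive_pfst0 total_recursive_psnd0] by simp

lemma total_recursive_pfst: "total_recursive f \<Longrightarrow> total_recursive (\<lambda>n. pfst (f n))"
  by (rule total_recursive_comp[OF total_recursive_pfst0])

lemma total_recursive_psnd: "total_recursive f \<Longrightarrow> total_recursive (\<lambda>n. psnd (f n))"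
  by (rule total_recursive_comp[OF total_recursive_psnd0])

lemma total_recursive_Suc: "total_recursive f \<Longrightarrow> total_recursive (\<lambda>n. Suc (f n))"
  by (rule total_recursive_comp[of Suc]) (simp_all add: total_recursive_def partial_recursive.succ)

lemma total_recursive_const: "total_recursive (\<lambda>_. c)"
  by (induction c) (auto intro: total_recursive_Suc simp: total_recursive_def[of "\<lambda>_. 0"] partial_recursive.zero)

text \<open>Functions of several arguments are made unary through \<open>pfst\<close> and
  \<open>psnd\<close>; this rule returns to the curried form in which they are used.\<close>

lemma total_recursive_comp2:
  assumes "total_recursive (\<lambda>z. f (pfst z) (psnd z))" "total_recursive g" "total_recursive h"
  shows "total_recursive (\<lambda>n. f (g n) (h n))"
  using total_recursive_comp[OF assms(1) total_recursive_pair[OF assms(2,3)]] by simp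

text \<open>On total data \<open>prim_iter\<close> never diverges and agrees with
  \<open>rec_nat\<close>. The rules for arithmetic and bounded sums follow by writing each operation
  as a \<open>rec_nat\<close> whose step may depend on the argument \<open>n\<close>.\<close>

lemma total_recursive_rec_nat:
  assumes "total_recursive f"
    and "total_recursive (\<lambda>z. g (pfst z) (pfst (psnd z)) (psnd (psnd z)))"
    and "total_recursive h"
  shows "total_recursive (\<lambda>n. rec_nat (f n) (g n) (h n))"
proof -
  let ?g = "\<lambda>z. g (pfst z) (pfst (psnd z)) (psnd (psnd z))"
  have "prim_iter (\<lambda>n. Some (f n)) (\<lambda>z. Some (?g z)) a y = Some (rec_nat (f a) (g a) y)" for a y
    by (induction y) auto
  then have "total_recursive (\<lambda>z. rec_nat (f (pfst z)) (g (pfst z)) (psnd z))"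
    using partial_recursive.prim_rec[of "\<lambda>n. Some (f n)" "\<lambda>z. Some (?g z)"] assms
    by (simp add: total_recursive_def)
  from total_recursive_comp2[where f = "\<lambda>a y. rec_nat (f a) (g a) y", OF this total_recursive_id assms(3)]
  show ?thesis .
qed

lemmas total_recursive_base =
  total_recursive_id total_recursive_const total_recursive_pfst total_recursive_psnd
  total_recursive_pair total_recursive_Suc

lemma total_recursive_add:
  assumes "total_recursive f" "total_recursive g"
  shows "total_recursive (\<lambda>n. f n + g n)"
proof -
  have "x + y = rec_nat x (\<lambda>_ i. Suc i) y" for x y :: nat
    by (induction y) auto
  then show ?thesis
    by (simp only:) (intro assms total_recursive_base total_recursive_rec_nat)
qed

lemma total_recursive_mult:
  assumes "total_recursive f" "total_recursive g"
  shows "total_recursive (\<lambda>n. f n * g n)"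
proof -
  have "x * y = rec_nat 0 (\<lambda>_ i. i + x) y" for x y :: nat
    by (induction y) auto
  then show ?thesis
    by (simp only:) (intro assms total_recursive_base total_recursive_rec_nat total_recursive_add
        total_recursive_comp[OF assms(1)])
qed

lemma total_recursive_diff:
  assumes "total_recursive f" "total_recursive g"
  shows "total_recursive (\<lambda>n. f n - g n)"
proof -
  have 1: "x - 1 = rec_nat 0 (\<lambda>y _. y) x" for x :: nat
    by (cases x) auto
  have "total_recursive (\<lambda>x. x - 1)"
    unfolding 1 by (intro total_recursive_base total_recursive_rec_nat)
  note 2 = total_recursive_comp[OF this]
  have "x - y = rec_nat x (\<lambda>_ i. i - 1) y" for x y :: nat
    by (induction y) auto
  \<comment> \<open>The right-hand side again contains a subtraction, so the equation would loop as
    a rewrite rule; the function is exchanged once as a whole.\<close>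
  then have "(\<lambda>n. f n - g n) = (\<lambda>n. rec_nat (f n) (\<lambda>_ i. i - 1) (g n))"
    by blast
  then show ?thesis
    by (rule ssubst) (intro assms total_recursive_base total_recursive_rec_nat 2)
qed

lemma total_recursive_power:
  assumes "total_recursive f" "total_recursive g"
  shows "total_recursive (\<lambda>n. f n ^ g n)"
proof -
  have "x ^ y = rec_nat 1 (\<lambda>_ i. x * i) y" for x y :: nat
    by (induction y) auto
  then show ?thesis
    by (simp only:) (intro assms total_recursive_base total_recursive_rec_nat total_recursive_mult
        total_recursive_comp[OF assms(1)])
qed

lemma total_recursive_sum:
  assumes "total_recursive (\<lambda>z. f (pfst z) (psnd z))" "total_recursive h"
  shows "total_recursive (\<lambda>n. \<Sum>i<h n. f n i)"
proof -
  have "(\<Sum>i<y. f x i) = rec_nat 0 (\<lambda>j a. a + f x j) y" for x y :: nat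
    by (induction y) auto
  then show ?thesis
    by (simp only:) (intro assms total_recursive_base total_recursive_rec_nat total_recursive_add
        total_recursive_comp2[OF assms(1)])
qed

section \<open>Decidable predicates and bounded quantifiers\<close>

abbreviation recursive_pred :: "(nat \<Rightarrow> bool) \<Rightarrow> bool" where
  "recursive_pred P \<equiv> total_recursive (\<lambda>n. of_bool (P n))"

lemma recursive_pred_not:
  assumes "recursive_pred P"
  shows "recursive_pred (\<lambda>n. \<not> P n)"
proof -
  have "of_bool (\<not> P n) = (1 - of_bool (P n) :: nat)" for n
    by simp
  then show ?thesis
    by (simp only:) (intro assms total_recursive_diff total_recursive_const)
qed

lemma recursive_pred_conj:
  "recursive_pred P \<Longrightarrow> recursive_pred Q \<Longrightarrow> recursive_pred (\<lambda>n. P n \<and> Q n)"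
  by (drule (1) total_recursive_mult) (simp only: of_bool_conj)

lemma recursive_pred_disj:
  assumes "recursive_pred P" "recursive_pred Q"
  shows "recursive_pred (\<lambda>n. P n \<or> Q n)"
  using recursive_pred_not[OF recursive_pred_conj[OF assms[THEN recursive_pred_not]]] by simp

lemma recursive_pred_le:
  assumes "total_recursive f" "total_recursive g"
  shows "recursive_pred (\<lambda>n. f n \<le> g n)"
proof -
  have "of_bool (x \<le> y) = 1 - (x - y)" for x y :: nat by auto
  then show ?thesis
    by (simp only:) (intro assms total_recursive_diff total_recursive_const)
qed

lemma recursive_pred_less:
  assumes "total_recursive f" "total_recursive g"
  shows "recursive_pred (\<lambda>n. f n < g n)"
  using recursive_pred_not[OF recursive_pred_le[OF assms(2,1)]] by (simp add: not_le)

lemma recursive_pred_eq: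
  assumes "total_recursive f" "total_recursive g"
  shows "recursive_pred (\<lambda>n. f n = g n)"
  using recursive_pred_conj[OF recursive_pred_le[OF assms] recursive_pred_le[OF assms(2,1)]]
  by (simp add: eq_iff)

text \<open>A bounded universal statement is decided by counting its counterexamples.\<close>

lemma recursive_pred_ball:
  assumes "recursive_pred (\<lambda>z. P (pfst z) (psnd z))" "total_recursive h"
  shows "recursive_pred (\<lambda>n. \<forall>i<h n. P n i)"
proof -
  have "(\<forall>i<y. P x i) \<longleftrightarrow> (\<Sum>i<y. of_bool (\<not> P x i)) = (0 :: nat)" for x y
    by auto
  then show ?thesis
    by (simp only:) (intro assms recursive_pred_eq total_recursive_sum recursive_pred_not total_recursive_const)
qed

lemma total_recursive_if:
  assumes "recursive_pred P" "total_recursive f" "total_recursive g"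
  shows "total_recursive (\<lambda>n. if P n then f n else g n)"
proof -
  have "(if P n then f n else g n) = of_bool (P n) * f n + of_bool (\<not> P n) * g n" for n
    by auto
  then show ?thesis
    by (simp only:) (intro assms total_recursive_add total_recursive_mult recursive_pred_not)
qed

text \<open>For \<open>y > 0\<close> the quotient counts the \<open>i\<close> with
  \<open>y * Suc i \<le> x\<close>, all of which lie below \<open>x\<close>. For
  \<open>y = 0\<close> this count would be \<open>x\<close> instead of the conventional value 0,
  hence the case distinction.\<close>

lemma total_recursive_div:
  assumes "total_recursive f" "total_recursive g"
  shows "total_recursive (\<lambda>n. f n div g n)"
proof -
  have "x div y = (if y = 0 then 0 else \<Sum>i<x. of_bool (y * Suc i \<le> x))" for x y :: nat
  proof (cases "y = 0")
    case False
    have "i < x div y \<longleftrightarrow> y * Suc i \<le> x" for i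
      using False less_eq_div_iff_mult_less_eq[of y "Suc i" x] by (simp add: Suc_le_eq mult.commute)
    moreover have "i < x" if "i < x div y" for i
      using that div_le_dividend[of x y] by linarith
    ultimately have "{i. i < x \<and> y * Suc i \<le> x} = {..<x div y}" by blast
    moreover have "(\<Sum>i<x. of_bool (y * Suc i \<le> x)) = card {i. i < x \<and> y * Suc i \<le> x}"
      by (simp add: of_bool_def sum.If_cases Int_def del: mult_Suc_right)
    ultimately show ?thesis using False by simp
  qed simp
  then show ?thesis
    by (simp only:) (intro assms total_recursive_base total_recursive_if recursive_pred_eq
      total_recursive_sum recursive_pred_le total_recursive_mult
      total_recursive_comp[OF assms(1)] total_recursive_comp[OF assms(2)])
qed

lemmas total_recursive_intros =
  total_recursive_base total_recursive_add total_recursive_mult total_recursive_diff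
  total_recursive_power total_recursive_sum total_recursive_div total_recursive_if
  recursive_pred_not recursive_pred_conj recursive_pred_disj recursive_pred_le
  recursive_pred_less recursive_pred_eq recursive_pred_ball

lemma recursive_pred_even: "total_recursive f \<Longrightarrow> recursive_pred (\<lambda>n. even (f n))"
proof -
  assume f: "total_recursive f"
  have "even x \<longleftrightarrow> 2 * (x div 2) = x" for x :: nat by presburger
  then show ?thesis
    by (simp only:) (intro total_recursive_intros f)
qed

section \<open>Unbounded search and stage approximations\<close>

text \<open>In place of \<open>LEAST\<close>, finitely many assertions about single values of
  \<open>h\<close>. Each of them becomes visible at some finite stage, which is what the stage
  approximation of a search requires.\<close>

lemma mu_search_eq_Some_iff:
  "mu_search h = Some n \<longleftrightarrow> h n = Some 0 \<and> (\<forall>m<n. \<exists>y. h m = Some (Suc y))"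
proof
  assume *: "mu_search h = Some n"
  then obtain k where k: "h k = Some 0" "\<forall>m<k. h m \<noteq> None" and n: "n = (LEAST n. h n = Some 0)"
    by (auto simp: mu_search_def split: if_splits)
  have "h n = Some 0" unfolding n by (rule LeastI[of _ k]) (rule k)
  moreover have "n \<le> k" unfolding n by (rule Least_le) (rule k)
  moreover have "h m \<noteq> Some 0" if "m < n" for m using that not_less_Least unfolding n by blast
  ultimately show "h n = Some 0 \<and> (\<forall>m<n. \<exists>y. h m = Some (Suc y))"
    using k(2) by (metis less_le_trans not0_implies_Suc option.exhaust)
next
  assume *: "h n = Some 0 \<and> (\<forall>m<n. \<exists>y. h m = Some (Suc y))"
  then have "(LEAST n. h n = Some 0) = n"
    by (intro Least_equality) (auto, metis leI nat.distinct(1) option.inject)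
  moreover have "\<forall>m<n. h m \<noteq> None" using * by fastforce
  ultimately show "mu_search h = Some n"
    using * unfolding mu_search_def by auto
qed

text \<open>The search runs through a total decidable predicate, so it can diverge only for want of
  a witness. The Kraft-Chaitin machine is computed in this form.\<close>

lemma partial_recursive_Least:
  assumes "recursive_pred (\<lambda>z. P (pfst z) (psnd z))"
    and "total_recursive (\<lambda>z. h (pfst z) (psnd z))"
  shows "partial_recursive (\<lambda>a. if \<exists>n. P a n then Some (h a (LEAST n. P a n)) else None)"
proof -
  \<comment> \<open>\<open>mu_search\<close> looks for a zero, so truth is turned into 0.\<close>
  let ?s = "\<lambda>a. mu_search (\<lambda>n. Some (1 - of_bool (P a n)))"
  have s: "?s a = (if \<exists>n. P a n then Some (LEAST n. P a n) else None)" for a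
    by (simp add: mu_search_def)
  have "total_recursive (\<lambda>z. 1 - of_bool (P (pfst z) (psnd z)))"
    by (intro total_recursive_intros assms)
  then have "partial_recursive ?s"
    using partial_recursive.search[of "\<lambda>z. Some (1 - of_bool (P (pfst z) (psnd z)))"]
    by (simp add: total_recursive_def)
  from partial_recursive.comp[OF _ partial_recursive.pair[OF _ this],
      of "\<lambda>z. Some (h (pfst z) (psnd z))" "\<lambda>n. Some n"]
  show ?thesis
    using assms(2) total_recursive_id unfolding s total_recursive_def
    by (simp add: if_distrib[of "\<lambda>x. Option.bind x _"] cong: if_cong)
qed

text \<open>The value 0 means that nothing has converged by stage \<open>s\<close>, and
  \<open>Suc y\<close> means that the value \<open>y\<close> has. Such approximations, built along
  the construction of \<open>f\<close>, stand in for step-bounded simulation of programs.\<close>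

definition stage_approximation :: "(nat \<Rightarrow> nat \<Rightarrow> nat) \<Rightarrow> (nat \<Rightarrow> nat option) \<Rightarrow> bool" where
  "stage_approximation F f \<longleftrightarrow>
     total_recursive (\<lambda>z. F (pfst z) (psnd z)) \<and>
     (\<forall>s t x y. s \<le> t \<longrightarrow> F s x = Suc y \<longrightarrow> F t x = Suc y) \<and>
     (\<forall>x y. f x = Some y \<longleftrightarrow> (\<exists>s. F s x = Suc y))"

lemma stage_approximationD:
  assumes "stage_approximation F f"
  shows "total_recursive g \<Longrightarrow> total_recursive h \<Longrightarrow> total_recursive (\<lambda>n. F (g n) (h n))"
    and "s \<le> t \<Longrightarrow> F s x = Suc y \<Longrightarrow> F t x = Suc y"
    and "f x = Some y \<longleftrightarrow> (\<exists>s. F s x = Suc y)"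
  using assms total_recursive_comp2[of F] unfolding stage_approximation_def by blast+

lemma stage_approximation_total:
  "total_recursive f \<Longrightarrow> stage_approximation (\<lambda>s x. Suc (f x)) (\<lambda>n. Some (f n))"
  by (auto simp: stage_approximation_def intro!: total_recursive_intros total_recursive_comp[of f])

text \<open>The two values may show up at different stages; by monotonicity the later stage shows
  both.\<close>

lemma stage_approximation_pair:
  assumes F: "stage_approximation F f" and G: "stage_approximation G g"
  shows "stage_approximation
    (\<lambda>s x. if F s x = 0 \<or> G s x = 0 then 0 else Suc (prod_encode (F s x - 1, G s x - 1)))
    (\<lambda>n. Option.bind (f n) (\<lambda>x. Option.bind (g n) (\<lambda>y. Some (prod_encode (x, y)))))"
proof -
  let ?P = "\<lambda>s x. if F s x = 0 \<or> G s x = 0 then 0 else Suc (prod_encode (F s x - 1, G s x - 1))"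
  have P: "?P s x = Suc v \<longleftrightarrow> (\<exists>y z. F s x = Suc y \<and> G s x = Suc z \<and> v = prod_encode (y, z))"
    for s x v by (cases "F s x"; cases "G s x") auto
  have "total_recursive (\<lambda>z. ?P (pfst z) (psnd z))"
    by (intro total_recursive_intros stage_approximationD(1)[OF F] stage_approximationD(1)[OF G])
  moreover have "?P t x = Suc y" if "s \<le> t" "?P s x = Suc y" for s t x y
    using that(2) stage_approximationD(2)[OF F that(1)] stage_approximationD(2)[OF G that(1)]
    unfolding P by blast
  moreover have "Option.bind (f n) (\<lambda>x. Option.bind (g n) (\<lambda>y. Some (prod_encode (x, y)))) = Some v
     \<longleftrightarrow> (\<exists>s. ?P s n = Suc v)" for n v
    unfolding P
  proof
    assume "Option.bind (f n) (\<lambda>x. Option.bind (g n) (\<lambda>y. Some (prod_encode (x, y)))) = Some v"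
    then obtain y z where "f n = Some y" "g n = Some z" and v: "v = prod_encode (y, z)"
      by (auto simp: bind_eq_Some_conv)
    then obtain s t where "F s n = Suc y" "G t n = Suc z"
      using stage_approximationD(3)[OF F] stage_approximationD(3)[OF G] by blast
    then have "F (max s t) n = Suc y" "G (max s t) n = Suc z"
      using stage_approximationD(2)[OF F, of s "max s t"] stage_approximationD(2)[OF G, of t "max s t"]
      by auto
    with v show "\<exists>s y z. F s n = Suc y \<and> G s n = Suc z \<and> v = prod_encode (y, z)" by blast
  qed (use stage_approximationD(3)[OF F] stage_approximationD(3)[OF G] in \<open>fastforce simp: bind_eq_Some_conv\<close>)
  ultimately show ?thesis unfolding stage_approximation_def by blast
qed

lemma stage_approximation_comp:
  assumes F: "stage_approximation F f" and G: "stage_approximation G g"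
  shows "stage_approximation (\<lambda>s x. if G s x = 0 then 0 else F s (G s x - 1))
    (\<lambda>n. Option.bind (g n) f)"
proof -
  let ?P = "\<lambda>s x. if G s x = 0 then 0 else F s (G s x - 1)"
  have P: "?P s x = Suc v \<longleftrightarrow> (\<exists>y. G s x = Suc y \<and> F s y = Suc v)"
    for s x v by (cases "G s x") auto
  have "total_recursive (\<lambda>z. ?P (pfst z) (psnd z))"
    by (intro total_recursive_intros stage_approximationD(1)[OF F] stage_approximationD(1)[OF G])
  moreover have "?P t x = Suc y" if "s \<le> t" "?P s x = Suc y" for s t x y
    using that(2) stage_approximationD(2)[OF F that(1)] stage_approximationD(2)[OF G that(1)]
    unfolding P by blast
  moreover have "Option.bind (g n) f = Some v \<longleftrightarrow> (\<exists>s. ?P s n = Suc v)" for n v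
    unfolding P
  proof
    assume "Option.bind (g n) f = Some v"
    then obtain y where "g n = Some y" "f y = Some v"
      by (auto simp: bind_eq_Some_conv)
    then obtain s t where "G s n = Suc y" "F t y = Suc v"
      using stage_approximationD(3)[OF F] stage_approximationD(3)[OF G] by blast
    then have "G (max s t) n = Suc y" "F (max s t) y = Suc v"
      using stage_approximationD(2)[OF G, of s "max s t"] stage_approximationD(2)[OF F, of t "max s t"]
      by auto
    then show "\<exists>s y. G s n = Suc y \<and> F s y = Suc v" by blast
  qed (use stage_approximationD(3)[OF F] stage_approximationD(3)[OF G] in \<open>fastforce simp: bind_eq_Some_conv\<close>)
  ultimately show ?thesis unfolding stage_approximation_def by blast
qed

text \<open>Every call of the recursion is cut off at the same stage \<open>s\<close>. By induction
  on the depth, the stages of the finitely many calls can be raised to a common one.\<close>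

lemma stage_approximation_prim_rec:
  assumes F: "stage_approximation F f" and G: "stage_approximation G g"
  shows "stage_approximation
    (\<lambda>s x. rec_nat (F s (pfst x))
       (\<lambda>y i. if i = 0 then 0 else G s (prod_encode (pfst x, prod_encode (y, i - 1)))) (psnd x))
    (\<lambda>n. prim_iter f g (pfst n) (psnd n))"
proof -
  define P where "P = (\<lambda>s a. rec_nat (F s a)
       (\<lambda>y i. if i = 0 then 0 else G s (prod_encode (a, prod_encode (y, i - 1)))))"
  have P0: "P s a 0 = F s a" for s a by (simp add: P_def)
  have PSuc: "P s a (Suc y) = Suc v \<longleftrightarrow>
      (\<exists>i. P s a y = Suc i \<and> G s (prod_encode (a, prod_encode (y, i))) = Suc v)" for s a y v
    by (cases "P s a y") (auto simp: P_def)
  have mono: "P t a y = Suc v" if "s \<le> t" "P s a y = Suc v" for s t a y v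
    using that(2)
  proof (induction y arbitrary: v)
    case 0 then show ?case using stage_approximationD(2)[OF F that(1)] by (simp add: P0)
  next
    case (Suc y) then show ?case using stage_approximationD(2)[OF G that(1)] unfolding PSuc by blast
  qed
  have lim: "prim_iter f g a y = Some v \<longleftrightarrow> (\<exists>s. P s a y = Suc v)" for a y v
  proof (induction y arbitrary: v)
    case 0 then show ?case using stage_approximationD(3)[OF F] by (simp add: P0)
  next
    case (Suc y)
    have "prim_iter f g a (Suc y) = Some v \<longleftrightarrow>
      (\<exists>i s t. P s a y = Suc i \<and> G t (prod_encode (a, prod_encode (y, i))) = Suc v)"
      using Suc.IH stage_approximationD(3)[OF G] by (auto simp: bind_eq_Some_conv)
    also have "\<dots> \<longleftrightarrow> (\<exists>s. P s a (Suc y) = Suc v)"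
      unfolding PSuc using mono stage_approximationD(2)[OF G] by (meson nle_le)
    finally show ?case .
  qed
  have "total_recursive (\<lambda>z. P (pfst z) (pfst (psnd z)) (psnd (psnd z)))"
    unfolding P_def
    by (intro total_recursive_intros total_recursive_rec_nat
        stage_approximationD(1)[OF F] stage_approximationD(1)[OF G])
  then have "stage_approximation (\<lambda>s x. P s (pfst x) (psnd x)) (\<lambda>n. prim_iter f g (pfst n) (psnd n))"
    unfolding stage_approximation_def using mono lim by blast
  then show ?thesis by (simp add: P_def)
qed

text \<open>At stage \<open>s\<close> only candidates \<open>n < s\<close> are tested: the value 1
  of \<open>F\<close> stands for the output 0, a value of at least 2 for a positive output. At most
  one candidate passes, so the sum has at most one nonzero term and returns it as
  \<open>Suc n\<close>.\<close>

lemma stage_approximation_search: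
  assumes F: "stage_approximation F f"
  shows "stage_approximation
    (\<lambda>s a. \<Sum>n<s. of_bool (F s (prod_encode (a, n)) = 1 \<and>
        (\<forall>m<n. 2 \<le> F s (prod_encode (a, m)))) * Suc n)
    (\<lambda>a. mu_search (\<lambda>n. f (prod_encode (a, n))))"
proof -
  define C where "C = (\<lambda>s a n. F s (prod_encode (a, n)) = 1 \<and> (\<forall>m<n. 2 \<le> F s (prod_encode (a, m))))"
  define P where "P = (\<lambda>s a. \<Sum>n<s. of_bool (C s a n) * Suc n)"
  have uniq: "n = n'" if "C s a n" "C s a n'" for s a n n'
    using that unfolding C_def by (cases n n' rule: linorder_cases) fastforce+
  have P: "P s a = Suc n \<longleftrightarrow> n < s \<and> C s a n" for s a n
  proof
    assume *: "n < s \<and> C s a n"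
    have "P s a = (\<Sum>m\<in>{n}. of_bool (C s a m) * Suc m)"
      unfolding P_def using * by (intro sum.mono_neutral_right) (auto dest: uniq)
    with * show "P s a = Suc n" by simp
  next
    assume *: "P s a = Suc n"
    then obtain m where m: "m < s" "C s a m"
      unfolding P_def by (metis (no_types, lifting) lessThan_iff mult_eq_0_iff nat.distinct(1)
          of_bool_eq_0_iff sum.neutral)
    have "P s a = (\<Sum>m\<in>{m}. of_bool (C s a m) * Suc m)"
      unfolding P_def using m by (intro sum.mono_neutral_right) (auto dest: uniq)
    with * m show "n < s \<and> C s a n" by simp
  qed
  have ge2: "2 \<le> v \<longleftrightarrow> (\<exists>y. v = Suc (Suc y))" for v
    by presburger
  have Cmono: "C t a n" if "s \<le> t" "C s a n" for s t a n
    using that stage_approximationD(2)[OF F that(1)] unfolding C_def ge2 One_nat_def by blast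
  have tr: "total_recursive (\<lambda>z. P (pfst z) (psnd z))"
    unfolding P_def C_def by (intro total_recursive_intros stage_approximationD(1)[OF F])
  have lim: "mu_search (\<lambda>n. f (prod_encode (a, n))) = Some n \<longleftrightarrow> (\<exists>s. P s a = Suc n)" for a n
    unfolding mu_search_eq_Some_iff P
  proof
    assume *: "f (prod_encode (a, n)) = Some 0 \<and> (\<forall>m<n. \<exists>y. f (prod_encode (a, m)) = Some (Suc y))"
    then obtain s0 where s0: "F s0 (prod_encode (a, n)) = Suc 0"
      using stage_approximationD(3)[OF F] by blast
    have "\<forall>m<n. \<exists>s y. F s (prod_encode (a, m)) = Suc (Suc y)"
      using * stage_approximationD(3)[OF F] by blast
    then obtain s where s: "\<forall>m<n. \<exists>y. F (s m) (prod_encode (a, m)) = Suc (Suc y)" by metis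
    \<comment> \<open>A stage beyond all the finitely many involved that also exceeds
      \<open>n\<close>.\<close>
    define t where "t = Suc n + s0 + (\<Sum>m<n. s m)"
    have "s m \<le> t" if "m < n" for m
      using member_le_sum[of m "{..<n}" s] that by (simp add: t_def)
    then have "\<forall>m<n. \<exists>y. F t (prod_encode (a, m)) = Suc (Suc y)"
      using s stage_approximationD(2)[OF F] by blast
    moreover have "F t (prod_encode (a, n)) = Suc 0"
      using stage_approximationD(2)[OF F _ s0, of t] by (simp add: t_def)
    moreover have "n < t" by (simp add: t_def)
    ultimately show "\<exists>s. n < s \<and> C s a n" unfolding C_def ge2 One_nat_def by blast
  next
    assume "\<exists>s. n < s \<and> C s a n"
    then show "f (prod_encode (a, n)) = Some 0 \<and> (\<forall>m<n. \<exists>y. f (prod_encode (a, m)) = Some (Suc y))"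
      using stage_approximationD(3)[OF F] unfolding C_def ge2 One_nat_def by blast
  qed
  have "stage_approximation P (\<lambda>a. mu_search (\<lambda>n. f (prod_encode (a, n))))"
    unfolding stage_approximation_def lim[symmetric] using tr lim Cmono
    by (auto simp: P intro: less_le_trans)
  then show ?thesis by (simp add: P_def C_def)
qed

text \<open>This takes the role of Kleene's normal form theorem: the graph of \<open>f\<close> is
  enumerated in recursive stages.\<close>

lemma partial_recursive_stage_approximation:
  "partial_recursive f \<Longrightarrow> \<exists>F. stage_approximation F f"
proof (induction rule: partial_recursive.induct)
  case (pair f g) then show ?case using stage_approximation_pair by blast
next
  case (comp f g) then show ?case using stage_approximation_comp by blast
next
  case (prim_rec f g) then show ?case using stage_approximation_prim_rec by blast
next
  case (search f) then show ?case using stage_approximation_search by blast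
qed (rule exI, rule stage_approximation_total, intro total_recursive_intros)+

section \<open>String codes\<close>

definition code_nth :: "nat \<Rightarrow> nat \<Rightarrow> nat" where
  "code_nth c i = (if i < length (list_decode c) then list_decode c ! i else 0)"

abbreviation code_length :: "nat \<Rightarrow> nat" where
  "code_length c \<equiv> length (list_decode c)"

lemma length_le_list_encode: "length xs \<le> list_encode xs"
proof (induction xs)
  case (Cons x xs)
  then show ?case using le_prod_encode_2[of "list_encode xs" x] by simp
qed simp

lemma prod_decode_0 [simp]: "prod_decode 0 = (0, 0)"
  using prod_encode_inverse[of "(0, 0)"] by (simp add: prod_encode_def)

text \<open>The code of \<open>x # xs\<close> is
  \<open>Suc (prod_encode (x, list_encode xs))\<close>, so subtracting 1 and taking the second
  component removes the head. The code 0 of the empty list stays fixed because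
  \<open>prod_decode 0 = (0, 0)\<close>.\<close>

lemma list_encode_drop:
  "rec_nat (list_encode xs) (\<lambda>_ c. psnd (c - 1)) i = list_encode (drop i xs)"
proof (induction i)
  case (Suc i)
  have "psnd (list_encode ys - 1) = list_encode (tl ys)" for ys
    by (cases ys) auto
  with Suc show ?case by (simp add: drop_Suc tl_drop)
qed simp

lemma total_recursive_drop:
  assumes "total_recursive f" "total_recursive g"
  shows "total_recursive (\<lambda>n. list_encode (drop (g n) (list_decode (f n))))"
  unfolding list_encode_drop[symmetric] list_decode_inverse
  by (intro total_recursive_intros total_recursive_rec_nat assms)

lemma total_recursive_code_nth:
  assumes "total_recursive f" "total_recursive g"
  shows "total_recursive (\<lambda>n. code_nth (f n) (g n))"
proof -
  have "code_nth c i = pfst (list_encode (drop i (list_decode c)) - 1)" for c i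
  proof (cases "i < length (list_decode c)")
    case True
    then have "drop i (list_decode c) = list_decode c ! i # drop (Suc i) (list_decode c)"
      by (rule Cons_nth_drop_Suc[symmetric])
    then show ?thesis using True by (simp add: code_nth_def)
  qed (simp add: code_nth_def)
  then show ?thesis
    by (simp only:) (intro total_recursive_intros total_recursive_drop assms)
qed

text \<open>The length is the number of nonempty tails, and by \<open>length_le_list_encode\<close>
  it is enough to count below the code itself.\<close>

lemma total_recursive_code_length:
  assumes "total_recursive f"
  shows "total_recursive (\<lambda>n. code_length (f n))"
proof -
  have "code_length c = (\<Sum>i<c. of_bool (list_encode (drop i (list_decode c)) \<noteq> 0))" for c
  proof -
    have z: "list_encode xs = 0 \<longleftrightarrow> xs = []" for xs by (cases xs) auto
    have "code_length c \<le> c" using length_le_list_encode[of "list_decode c"] by simp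
    then have "{i. i < c \<and> i < code_length c} = {..<code_length c}" by auto
    then show ?thesis
      by (simp add: z of_bool_def sum.If_cases Int_def not_le)
  qed
  then have "total_recursive (\<lambda>c. code_length c)"
    by (rule ssubst[OF ext]) (intro total_recursive_intros total_recursive_drop)
  from total_recursive_comp[OF this assms] show ?thesis .
qed

lemma total_recursive_map_upt:
  assumes "total_recursive (\<lambda>z. f (pfst z) (psnd z))" "total_recursive h"
  shows "total_recursive (\<lambda>n. list_encode (map (f n) [0..<h n]))"
proof -
  \<comment> \<open>List codes grow at the front, so the recursion starts from the last entry; after
    \<open>k\<close> steps it has produced the last \<open>k\<close> entries.\<close>
  have "rec_nat 0 (\<lambda>j c. Suc (prod_encode (g (m - Suc j), c))) k = list_encode (map g [m - k..<m])"
    if "k \<le> m" for g :: "nat \<Rightarrow> nat" and k m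
    using that
  proof (induction k)
    case (Suc k)
    then have "[m - Suc k..<m] = (m - Suc k) # [m - k..<m]"
      by (simp add: upt_rec[of "m - Suc k"] Suc_diff_Suc)
    with Suc show ?case by simp
  qed simp
  from this[of m m for m, OF le_refl, symmetric]
  have "list_encode (map g [0..<m]) = rec_nat 0 (\<lambda>j c. Suc (prod_encode (g (m - Suc j), c))) m" for g m
    by simp
  then show ?thesis
    by (simp only:) (intro total_recursive_intros total_recursive_rec_nat
        total_recursive_comp2[OF assms(1)] total_recursive_comp[OF assms(2)] assms)
qed

lemma inj_string_code: "inj string_code"
proof (rule injI)
  fix \<sigma> \<tau> assume "string_code \<sigma> = string_code \<tau>"
  then have "map of_bool \<sigma> = (map of_bool \<tau> :: nat list)"
    by (simp add: string_code_def list_encode_eq)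
  moreover have "inj (of_bool :: bool \<Rightarrow> nat)" by (auto simp: inj_on_def)
  ultimately show "\<sigma> = \<tau>" by (simp add: inj_map_eq_map)
qed

lemma string_code_eq_iff [simp]: "string_code \<sigma> = string_code \<tau> \<longleftrightarrow> \<sigma> = \<tau>"
  using inj_string_code by (simp add: inj_eq)

lemma code_length_string_code [simp]: "code_length (string_code \<sigma>) = length \<sigma>"
  by (simp add: string_code_def)

lemma code_nth_string_code [simp]: "code_nth (string_code \<sigma>) i = of_bool (i < length \<sigma> \<and> \<sigma> ! i)"
  by (simp add: string_code_def code_nth_def)

lemma length_le_string_code: "length \<sigma> \<le> string_code \<sigma>"
  using length_le_list_encode[of "map of_bool \<sigma>"] by (simp add: string_code_def)

abbreviation is_string_code :: "nat \<Rightarrow> bool" where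
  "is_string_code c \<equiv> c \<in> range string_code"

lemma is_string_code_iff: "is_string_code c \<longleftrightarrow> (\<forall>i<code_length c. code_nth c i \<le> 1)"
proof
  assume *: "\<forall>i<code_length c. code_nth c i \<le> 1"
  have "map of_bool (map (\<lambda>x. x = 1) (list_decode c)) = list_decode c"
    using * by (auto intro!: nth_equalityI simp: code_nth_def le_Suc_eq)
  then have "string_code (map (\<lambda>x. x = 1) (list_decode c)) = c"
    by (simp add: string_code_def)
  then show "is_string_code c" by (metis rangeI)
qed auto

lemma recursive_pred_is_string_code:
  assumes "total_recursive f"
  shows "recursive_pred (\<lambda>n. is_string_code (f n))"
  unfolding is_string_code_iff
  by (intro total_recursive_intros total_recursive_code_nth total_recursive_code_length
      total_recursive_comp[OF assms] assms)

section \<open>The Kraft-Chaitin theorem\<close>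

text \<open>A string \<sigma> names the dyadic interval of length
  \<open>1 / 2 ^ length \<sigma>\<close> that starts at
  \<open>binary_value \<sigma> / 2 ^ length \<sigma>\<close>. The form as a sum lets this number be
  computed from \<open>string_code \<sigma>\<close>.\<close>

definition binary_value :: "bool list \<Rightarrow> nat" where
  "binary_value \<sigma> = (\<Sum>i<length \<sigma>. of_bool (\<sigma> ! i) * 2 ^ (length \<sigma> - Suc i))"

lemma binary_value_simps [simp]:
  "binary_value [] = 0"
  "binary_value (b # \<sigma>) = of_bool b * 2 ^ length \<sigma> + binary_value \<sigma>"
  by (simp_all add: binary_value_def sum.lessThan_Suc_shift del: sum.lessThan_Suc)

lemma binary_value_append:
  "binary_value (\<sigma> @ \<tau>) = binary_value \<sigma> * 2 ^ length \<tau> + binary_value \<tau>"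
  by (induction \<sigma>) (auto simp: algebra_simps power_add)

lemma binary_value_less: "binary_value \<sigma> < 2 ^ length \<sigma>"
  by (induction \<sigma>) auto

lemma ex_binary_value: "t < 2 ^ m \<Longrightarrow> \<exists>\<sigma>. length \<sigma> = m \<and> binary_value \<sigma> = t"
proof (induction m arbitrary: t)
  case (Suc m)
  show ?case
  proof (cases "t < 2 ^ m")
    case True
    then obtain \<sigma> where "length \<sigma> = m" "binary_value \<sigma> = t" using Suc by blast
    then show ?thesis by (intro exI[of _ "False # \<sigma>"]) simp
  next
    case False
    then have "t - 2 ^ m < 2 ^ m" using Suc.prems by simp
    then obtain \<sigma> where "length \<sigma> = m" "binary_value \<sigma> = t - 2 ^ m" using Suc by blast
    then show ?thesis using False by (intro exI[of _ "True # \<sigma>"]) simp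
  qed
qed simp

definition prefix_free :: "bool list set \<Rightarrow> bool" where
  "prefix_free D \<longleftrightarrow> (\<forall>\<sigma>\<in>D. \<forall>\<tau>\<in>D. prefix \<sigma> \<tau> \<longrightarrow> \<sigma> = \<tau>)"

text \<open>Extend all strings of \<open>D\<close> to a common length \<open>N\<close>. A string
  \<tau> has \<open>2 ^ (N - length \<tau>)\<close> extensions, different strings of
  \<open>D\<close> have disjoint ones, and only \<open>2 ^ N\<close> strings are available.\<close>

lemma kraft_inequality:
  assumes "prefix_free D" "finite D"
  shows "(\<Sum>\<tau>\<in>D. (1 / 2 :: real) ^ length \<tau>) \<le> 1"
proof -
  define N where "N = Max (insert 0 (length ` D))"
  have N: "length \<tau> \<le> N" if "\<tau> \<in> D" for \<tau>
    unfolding N_def using assms(2) that by (intro Max_ge) auto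
  define E where "E \<tau> = (@) \<tau> ` {\<rho>. length \<rho> = N - length \<tau>}" for \<tau> :: "bool list"
  have fin: "finite {\<rho> :: bool list. length \<rho> = n}" for n
    using finite_lists_length_eq[of "UNIV :: bool set" n] by simp
  have card: "card {\<rho> :: bool list. length \<rho> = n} = 2 ^ n" for n
    using card_lists_length_eq[of "UNIV :: bool set" n] by simp
  have "card (\<Union>\<tau>\<in>D. E \<tau>) = (\<Sum>\<tau>\<in>D. card (E \<tau>))"
  proof (rule card_UN_disjoint)
    show "\<forall>\<sigma>\<in>D. \<forall>\<tau>\<in>D. \<sigma> \<noteq> \<tau> \<longrightarrow> E \<sigma> \<inter> E \<tau> = {}"
    proof (intro ballI impI)
      fix \<sigma> \<tau> assume "\<sigma> \<in> D" "\<tau> \<in> D" "\<sigma> \<noteq> \<tau>"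
      then have "\<not> prefix \<sigma> \<tau>" "\<not> prefix \<tau> \<sigma>" using assms(1) unfolding prefix_free_def by auto
      then show "E \<sigma> \<inter> E \<tau> = {}"
        unfolding E_def by (auto dest: prefix_same_cases[OF prefixI prefixI[OF sym]])
    qed
  qed (use assms(2) fin in \<open>auto simp: E_def\<close>)
  also have "\<dots> = (\<Sum>\<tau>\<in>D. 2 ^ (N - length \<tau>))"
    by (intro sum.cong) (auto simp: E_def card_image inj_on_def card)
  finally have "(\<Sum>\<tau>\<in>D. 2 ^ (N - length \<tau>)) = card (\<Union>\<tau>\<in>D. E \<tau>)" ..
  also have "\<dots> \<le> card {\<rho> :: bool list. length \<rho> = N}"
    using N by (intro card_mono fin) (auto simp: E_def)
  finally have "(\<Sum>\<tau>\<in>D. 2 ^ (N - length \<tau>)) \<le> (2 :: nat) ^ N" by (simp add: card)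
  then have "real (\<Sum>\<tau>\<in>D. 2 ^ (N - length \<tau>)) \<le> 2 ^ N"
    by (metis of_nat_le_iff of_nat_numeral of_nat_power)
  moreover have "real (\<Sum>\<tau>\<in>D. 2 ^ (N - length \<tau>)) = 2 ^ N * (\<Sum>\<tau>\<in>D. (1 / 2) ^ length \<tau>)"
    unfolding sum_distrib_left of_nat_sum
    by (intro sum.cong) (auto simp: N power_diff[of "2 :: real"] power_one_over)
  ultimately show ?thesis by simp
qed

text \<open>The requests are enumerated as \<open>u = (request, first witness)\<close>. Request \<open>u\<close> of length \<open>l\<close> owns
  the interval from \<open>S u\<close> to \<open>S u + 1 / 2 ^ l\<close>, which contains a dyadic interval of length
  \<open>1 / 2 ^ (l + 1)\<close>; giving up this one bit avoids the bookkeeping of the sharp version.\<close>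

theorem kraft_chaitin:
  fixes R :: "(nat \<times> bool list) set"
  assumes P: "recursive_pred (\<lambda>z. P (pfst z) (psnd z))"
    and R: "\<And>l \<sigma>. (l, \<sigma>) \<in> R \<longleftrightarrow> (\<exists>w. P (prod_encode (l, string_code \<sigma>)) w)"
    and weight: "\<And>F. finite F \<Longrightarrow> F \<subseteq> R \<Longrightarrow> (\<Sum>(l, \<sigma>)\<in>F. (1 / 2 :: real) ^ l) \<le> 1"
  shows "\<exists>M. prefix_free_machine M \<and> (\<forall>l \<sigma>. (l, \<sigma>) \<in> R \<longrightarrow> (\<exists>\<tau>. length \<tau> = Suc l \<and> M \<tau> = Some \<sigma>))"
proof -
  define V where "V u \<longleftrightarrow> (P (pfst u) (psnd u) \<and> (\<forall>w<psnd u. \<not> P (pfst u) w)) \<and>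
    is_string_code (psnd (pfst u))" for u
  define L where "L u = pfst (pfst u)" for u
  define X where "X u = psnd (pfst u)" for u
  \<comment> \<open>\<open>N u\<close> is \<open>S u\<close> scaled by \<open>2 ^ u\<close>. Since
    \<open>L v \<le> v < u\<close>, no exponent is truncated, and intervals can be compared by
    recursive arithmetic on natural numbers.\<close>
  define N :: "nat \<Rightarrow> nat" where "N u = (\<Sum>v<u. of_bool (V v) * 2 ^ (u - L v))" for u
  define S where "S u = (\<Sum>v<u. of_bool (V v) * (1 / 2 :: real) ^ L v)" for u
  have L_le: "L u \<le> u" for u
    unfolding L_def by (metis le_prod_encode_1 le_trans prod.collapse prod_decode_inverse)
  have N: "real (N u) = S u * 2 ^ u" for u
  proof -
    have "L v \<le> u" if "v < u" for v using L_le[of v] that by simp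
    then show ?thesis
      unfolding N_def S_def of_nat_sum sum_distrib_right
      by (intro sum.cong) (auto simp: power_diff[of "2 :: real"] power_one_over)
  qed
  have S_le_1: "S u \<le> 1" for u
  proof -
    define f where "f v = (L v, inv string_code (X v))" for v
    have f: "string_code (snd (f v)) = X v" if "V v" for v
      using that by (simp add: f_def V_def X_def f_inv_into_f)
    \<comment> \<open>A valid index is determined by its request because its witness is the least
      one. So \<open>S u\<close> is a sum over distinct requests in \<open>R\<close>, to which
      \<open>weight\<close> applies.\<close>
    have "v = v'" if "V v" "V v'" "f v = f v'" for v v'
    proof -
      have "pfst v = pfst v'"
        using that(3) f[OF that(1)] f[OF that(2)]
        by (metis L_def X_def f_def fst_conv prod.collapse prod_decode_inverse)
      moreover from this have "psnd v = psnd v'"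
        using that(1,2) unfolding V_def by (metis linorder_neqE_nat)
      ultimately show ?thesis by (metis prod.collapse prod_decode_inverse)
    qed
    then have inj: "inj_on f {v\<in>{..<u}. V v}" by (auto intro: inj_onI)
    have "S u = (\<Sum>v\<in>{v\<in>{..<u}. V v}. (1 / 2) ^ L v)"
      unfolding S_def by (intro sum.mono_neutral_cong_right) auto
    also have "\<dots> = (\<Sum>(l, \<sigma>)\<in>f ` {v\<in>{..<u}. V v}. (1 / 2) ^ l)"
      using inj by (subst sum.reindex) (auto simp: f_def)
    also have "\<dots> \<le> 1"
    proof (rule weight)
      show "f ` {v\<in>{..<u}. V v} \<subseteq> R"
      proof clarify
        fix v l \<sigma> assume "V v" "(l, \<sigma>) = f v"
        then have "prod_encode (l, string_code \<sigma>) = pfst v"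
          using f[of v] by (simp add: f_def L_def X_def)
        with \<open>V v\<close> show "(l, \<sigma>) \<in> R" unfolding R V_def by metis
      qed
    qed simp
    finally show ?thesis .
  qed
  have S_Suc: "S (Suc u) = S u + (1 / 2) ^ L u" if "V u" for u
    using that by (simp add: S_def)
  have S_mono: "S u \<le> S v" if "u \<le> v" for u v
    unfolding S_def using that by (intro sum_mono2) auto
  \<comment> \<open>Divided by \<open>2 ^ (m + u)\<close>, this says that the dyadic interval with
    number \<open>b\<close> at length \<open>m\<close> lies inside the interval of request
    \<open>u\<close>, whose length is \<open>2 / 2 ^ m\<close> because
    \<open>m = Suc (L u)\<close>.\<close>
  define E where "E b m u \<longleftrightarrow> V u \<and> m = Suc (L u) \<and> N u * 2 ^ m \<le> b * 2 ^ u \<and>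
    (b + 1) * 2 ^ u \<le> N u * 2 ^ m + 2 * 2 ^ u" for b m u
  have E: "S u \<le> b / 2 ^ m \<and> (b + 1) / 2 ^ m \<le> S (Suc u)" if "E b m u" for b m u
  proof -
    have "V u" and m: "m = Suc (L u)" and 1: "N u * 2 ^ m \<le> b * 2 ^ u"
      and 2: "(b + 1) * 2 ^ u \<le> N u * 2 ^ m + 2 * 2 ^ u"
      using that by (auto simp: E_def)
    have "real (N u * 2 ^ m) \<le> real (b * 2 ^ u)" using 1 by (simp only: of_nat_le_iff)
    then have "S u * 2 ^ m * 2 ^ u \<le> real b * 2 ^ u" by (simp add: N ac_simps)
    moreover have "real ((b + 1) * 2 ^ u) \<le> real (N u * 2 ^ m + 2 * 2 ^ u)"
      using 2 by (simp only: of_nat_le_iff)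
    then have "(real b + 1) * 2 ^ u \<le> (S u * 2 ^ m + 2) * 2 ^ u" by (simp add: N algebra_simps)
    ultimately have "S u * 2 ^ m \<le> b" "real b + 1 \<le> S u * 2 ^ m + 2"
      by (simp_all only: mult_le_cancel_right_pos zero_less_power zero_less_numeral)
    then show ?thesis
      using S_Suc[OF \<open>V u\<close>] by (simp add: m field_simps power_one_over)
  qed
  define M where "M \<tau> = (if \<exists>u. E (binary_value \<tau>) (length \<tau>) u
    then Some (inv string_code (X (LEAST u. E (binary_value \<tau>) (length \<tau>) u))) else None)" for \<tau>
  have "prefix_free_machine M"
    unfolding prefix_free_machine_def
  proof (intro conjI ballI impI)
    define B where "B c = (\<Sum>i<code_length c. code_nth c i * 2 ^ (code_length c - Suc i))" for c
    have B: "B (string_code \<tau>) = binary_value \<tau>" for \<tau>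
      by (simp add: B_def binary_value_def)
    \<comment> \<open>The same search as in \<open>M\<close>, carried out on codes; \<open>B\<close>
      is \<open>binary_value\<close> read from a code.\<close>
    define \<phi> where "\<phi> c = (if \<exists>u. E (B c) (code_length c) u
      then Some (X (LEAST u. E (B c) (code_length c) u)) else None)" for c
    have V: "recursive_pred (\<lambda>n. V (f n))" if "total_recursive f" for f
      unfolding V_def by (intro total_recursive_intros recursive_pred_is_string_code
        total_recursive_comp2[where f="\<lambda>x y. of_bool (P x y)", OF P] that
        total_recursive_comp[OF that])
    have "partial_recursive \<phi>"
      unfolding \<phi>_def[abs_def]
      by (rule partial_recursive_Least; unfold E_def N_def L_def X_def B_def;
          intro total_recursive_intros V total_recursive_code_nth total_recursive_code_length)
    moreover have "\<phi> (string_code \<tau>) = map_option string_code (M \<tau>)" for \<tau>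
    proof -
      have "is_string_code (X u)" if "E b m u" for b m u
        using that by (auto simp: E_def V_def X_def)
      then have "is_string_code (X (LEAST u. E b m u))" if "E b m u" for b m u
        using LeastI[of "E b m", OF that] by blast
      then show ?thesis
        by (auto simp: \<phi>_def M_def B intro!: f_inv_into_f[symmetric])
    qed
    ultimately show "recursive_machine M" unfolding recursive_machine_def by blast
  next
    fix \<sigma> \<tau> assume "\<sigma> \<in> dom M" "\<tau> \<in> dom M" "prefix \<sigma> \<tau>"
    then obtain u v \<rho> where u: "E (binary_value \<sigma>) (length \<sigma>) u" and v: "E (binary_value \<tau>) (length \<tau>) v"
      and \<tau>: "\<tau> = \<sigma> @ \<rho>"
      by (auto simp: M_def prefix_def split: if_splits)
    have le: "binary_value \<sigma> * 2 ^ length \<rho> \<le> binary_value \<tau>"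
      "binary_value \<tau> + 1 \<le> (binary_value \<sigma> + 1) * 2 ^ length \<rho>"
      using binary_value_less[of \<rho>] by (auto simp: \<tau> binary_value_append algebra_simps)
    have "binary_value \<sigma> / 2 ^ length \<sigma> \<le> binary_value \<tau> / 2 ^ length \<tau>"
      using of_nat_mono[OF le(1), where 'a = real] by (simp add: \<tau> power_add field_simps)
    moreover have "(real (binary_value \<tau>) + 1) / 2 ^ length \<tau> \<le> (real (binary_value \<sigma>) + 1) / 2 ^ length \<sigma>"
    proof -
      have "real (binary_value \<tau> + 1) / 2 ^ length \<tau> \<le>
          real ((binary_value \<sigma> + 1) * 2 ^ length \<rho>) / 2 ^ length \<tau>"
        by (intro divide_right_mono of_nat_mono le(2)) simp
      also have "\<dots> = (real (binary_value \<sigma>) + 1) / 2 ^ length \<sigma>"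
        by (simp only: \<tau> length_append power_add of_nat_mult of_nat_power of_nat_numeral) simp
      finally show ?thesis by (simp add: add.commute)
    qed
    moreover have "binary_value \<tau> / 2 ^ length \<tau> < (real (binary_value \<tau>) + 1) / 2 ^ length \<tau>"
      by (intro divide_strict_right_mono) auto
    \<comment> \<open>The interval of \<tau> has positive length and lies in that of \<sigma>, so
      the request intervals of \<open>u\<close> and \<open>v\<close> overlap. For
      \<open>u \<noteq> v\<close>, monotonicity of \<open>S\<close> would make one of them end
      before or where the other begins.\<close>
    ultimately have "S u < S (Suc v)" "S v < S (Suc u)"
      using E[OF u] E[OF v] by linarith+
    then have "u = v"
      using S_mono[of "Suc v" u] S_mono[of "Suc u" v] by (metis linorder_not_less not_less_eq_eq order_antisym_conv)
    then have "length \<sigma> = length \<tau>" using u v by (simp add: E_def)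
    then show "\<sigma> = \<tau>" by (simp add: \<tau>)
  qed
  moreover have "\<exists>\<tau>. length \<tau> = Suc l \<and> M \<tau> = Some \<sigma>" if "(l, \<sigma>) \<in> R" for l \<sigma>
  proof -
    let ?z = "prod_encode (l, string_code \<sigma>)"
    define u where "u = prod_encode (?z, LEAST w. P ?z w)"
    have "P ?z (LEAST w. P ?z w)" using that unfolding R by (rule LeastI_ex)
    then have "V u" by (auto simp: V_def u_def dest: not_less_Least)
    have Lu: "L u = l" and Xu: "X u = string_code \<sigma>" by (simp_all add: L_def X_def u_def)
    define m where "m = Suc l"
    \<comment> \<open>The first multiple of \<open>1 / 2 ^ m\<close> not below \<open>S u\<close>.
      Less than one step is lost, and the request interval is two steps long, so a full dyadic
      interval fits.\<close>
    define b where "b = nat \<lceil>S u * 2 ^ m\<rceil>"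
    have "0 \<le> S u" by (simp add: S_def sum_nonneg)
    then have b: "S u * 2 ^ m \<le> b" "b < S u * 2 ^ m + 1"
      unfolding b_def by (auto simp: of_nat_nat) linarith+
    \<comment> \<open>The interval of request \<open>u\<close> ends no later than 1, so
      \<open>b\<close> is small enough to be the value of a string of length
      \<open>m\<close>.\<close>
    have "S u * 2 ^ m + 2 \<le> 2 ^ m"
      using S_le_1[of "Suc u"] S_Suc[OF \<open>V u\<close>] by (simp add: Lu m_def field_simps power_one_over)
    with b have "real b < 2 ^ m" by linarith
    then have "b < 2 ^ m" by (metis of_nat_less_iff of_nat_numeral of_nat_power)
    then obtain \<tau> where \<tau>: "length \<tau> = m" "binary_value \<tau> = b" using ex_binary_value by blast
    have "S u * 2 ^ m * 2 ^ u \<le> real b * 2 ^ u" "(real b + 1) * 2 ^ u \<le> (S u * 2 ^ m + 2) * 2 ^ u"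
      using b by auto
    then have "real (N u * 2 ^ m) \<le> real (b * 2 ^ u)"
      "real ((b + 1) * 2 ^ u) \<le> real (N u * 2 ^ m + 2 * 2 ^ u)"
      by (simp_all add: N algebra_simps)
    then have Eu: "E (binary_value \<tau>) (length \<tau>) u"
      unfolding of_nat_le_iff using \<open>V u\<close> by (simp add: E_def \<tau> m_def Lu)
    have "u = v" if "E (binary_value \<tau>) (length \<tau>) v" for v
    proof -
      have "real b / 2 ^ m < (real b + 1) / 2 ^ m"
        by (intro divide_strict_right_mono) auto
      then have "S u < S (Suc v)" "S v < S (Suc u)"
        using E[OF that] E[OF Eu] \<tau> by (auto simp: \<tau>)
      then show ?thesis
        using S_mono[of "Suc v" u] S_mono[of "Suc u" v] by (metis linorder_not_less not_less_eq_eq order_antisym_conv)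
    qed
    then have "(LEAST u. E (binary_value \<tau>) (length \<tau>) u) = u"
      using Eu by (metis LeastI)
    then have "M \<tau> = Some \<sigma>" using Eu by (auto simp: M_def Xu inv_f_f[OF inj_string_code])
    then show ?thesis using \<tau> by (auto simp: m_def)
  qed
  ultimately show ?thesis by blast
qed

section \<open>Coding theorem and interleaving\<close>

text \<open>The exponents are distinct, so the sum is dominated by the geometric tail from
  \<open>m\<close> on.\<close>

lemma sum_half_powers_le:
  assumes "finite C" "\<And>c. c \<in> C \<Longrightarrow> m \<le> c"
  shows "(\<Sum>c\<in>C. (1 / 2 :: real) ^ c) \<le> 2 * (1 / 2) ^ m"
proof -
  obtain N where N: "\<forall>c\<in>C. c < N" using assms(1) by (meson finite_nat_set_iff_bounded)
  have eq: "(\<Sum>i<n. (1 / 2 :: real) ^ (m + i)) = 2 * (1 / 2) ^ m - 2 * (1 / 2) ^ (m + n)" for n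
    by (induction n) simp_all
  have "(\<Sum>c\<in>C. (1 / 2 :: real) ^ c) \<le> (\<Sum>c\<in>(+) m ` {..<N}. (1 / 2) ^ c)"
  proof (rule sum_mono2)
    show "C \<subseteq> (+) m ` {..<N}"
    proof
      fix c assume "c \<in> C"
      then have "c = m + (c - m)" "c - m < N" using assms(2) N by (auto intro: le_less_trans[OF diff_le_self])
      then show "c \<in> (+) m ` {..<N}" by blast
    qed
  qed auto
  also have "\<dots> = (\<Sum>i<N. (1 / 2) ^ (m + i))"
    by (subst sum.reindex) auto
  also have "\<dots> \<le> 2 * (1 / 2) ^ m" unfolding eq by simp
  finally show ?thesis .
qed

text \<open>Here \<open>q n\<close> is a weight and \<open>k\<close> a level that it has reached.
  For fixed \<open>n\<close> the levels form a geometric sum governed by the least of them, hence at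
  most \<open>2 * q n\<close>, and the \<open>q n\<close> add up to at most 1.\<close>

lemma sum_levels_le:
  fixes q :: "nat \<Rightarrow> real"
  assumes "finite G" and le: "\<And>n k. (n, k) \<in> G \<Longrightarrow> (1 / 2) ^ k \<le> q n"
    and q: "\<And>N. finite N \<Longrightarrow> (\<Sum>n\<in>N. q n) \<le> 1"
  shows "(\<Sum>(n, k)\<in>G. (1 / 2 :: real) ^ k) \<le> 2"
proof -
  have fin: "finite {k. (n, k) \<in> G}" for n
    by (rule finite_subset[of _ "snd ` G"]) (use assms(1) in \<open>force+\<close>)
  have G: "G = (SIGMA n:fst ` G. {k. (n, k) \<in> G})" by force
  have "(\<Sum>(n, k)\<in>G. (1 / 2 :: real) ^ k) = (\<Sum>n\<in>fst ` G. \<Sum>k\<in>{k. (n, k) \<in> G}. (1 / 2) ^ k)"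
    by (subst sum.Sigma) (use assms(1) fin G in auto)
  also have "\<dots> \<le> (\<Sum>n\<in>fst ` G. 2 * q n)"
  proof (rule sum_mono)
    fix n assume "n \<in> fst ` G"
    then have "(n, LEAST k. (n, k) \<in> G) \<in> G" by (auto intro: LeastI)
    then have "2 * (1 / 2) ^ (LEAST k. (n, k) \<in> G) \<le> 2 * q n" using le by simp
    moreover have "(\<Sum>k\<in>{k. (n, k) \<in> G}. (1 / 2 :: real) ^ k) \<le> 2 * (1 / 2) ^ (LEAST k. (n, k) \<in> G)"
      by (rule sum_half_powers_le[OF fin]) (auto intro: Least_le)
    ultimately show "(\<Sum>k\<in>{k. (n, k) \<in> G}. (1 / 2 :: real) ^ k) \<le> 2 * q n" by linarith
  qed
  also have "\<dots> \<le> 2"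
    using q[of "fst ` G"] assms(1) by (simp add: sum_distrib_left[symmetric])
  finally show ?thesis .
qed

section \<open>Complexity with respect to a universal machine\<close>

locale universal_machine =
  fixes U :: machine
  assumes universal: "universal_prefix_free_machine U"
begin

lemma prefix_free_U: "prefix_free_machine U"
  using universal unfolding universal_prefix_free_machine_def by blast

lemma K_le: "U \<tau> = Some \<sigma> \<Longrightarrow> K U \<sigma> \<le> length \<tau>"
  unfolding K_def by (rule Least_le) blast

lemma K_le_machine:
  assumes "prefix_free_machine M"
  shows "\<exists>c. \<forall>\<tau> \<sigma>. M \<tau> = Some \<sigma> \<longrightarrow> K U \<sigma> \<le> length \<tau> + c"
proof -
  obtain \<rho> where "\<And>\<sigma>. U (\<rho> @ \<sigma>) = M \<sigma>"
    using universal assms unfolding universal_prefix_free_machine_def by blast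
  then have "\<forall>\<tau> \<sigma>. M \<tau> = Some \<sigma> \<longrightarrow> K U \<sigma> \<le> length \<tau> + length \<rho>"
    using K_le by (metis add.commute length_append)
  then show ?thesis by blast
qed

text \<open>Upper bounds on \<open>K\<close> now only need a set of requests: the extra bit of
  \<open>kraft_chaitin\<close> and the length of the simulating prefix go into
  \<open>c\<close>.\<close>

lemma K_le_request:
  fixes R :: "(nat \<times> bool list) set"
  assumes "recursive_pred (\<lambda>z. P (pfst z) (psnd z))"
    and "\<And>l \<sigma>. (l, \<sigma>) \<in> R \<longleftrightarrow> (\<exists>w. P (prod_encode (l, string_code \<sigma>)) w)"
    and "\<And>F. finite F \<Longrightarrow> F \<subseteq> R \<Longrightarrow> (\<Sum>(l, \<sigma>)\<in>F. (1 / 2 :: real) ^ l) \<le> 1"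
  shows "\<exists>c. \<forall>l \<sigma>. (l, \<sigma>) \<in> R \<longrightarrow> K U \<sigma> \<le> l + c"
proof -
  obtain M where "prefix_free_machine M" and M: "\<forall>l \<sigma>. (l, \<sigma>) \<in> R \<longrightarrow> (\<exists>\<tau>. length \<tau> = Suc l \<and> M \<tau> = Some \<sigma>)"
    using kraft_chaitin[of P R] assms by blast
  then obtain c where c: "\<forall>\<tau> \<sigma>. M \<tau> = Some \<sigma> \<longrightarrow> K U \<sigma> \<le> length \<tau> + c"
    using K_le_machine by blast
  have "K U \<sigma> \<le> l + Suc c" if "(l, \<sigma>) \<in> R" for l \<sigma>
    using M c that by (metis add_Suc add_Suc_right)
  then show ?thesis by blast
qed

text \<open>\<open>K\<close> is a \<open>LEAST\<close>, so the existence of a description comes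
  first. Requesting each \<sigma> at length \<open>Suc (string_code \<sigma>)\<close> uses distinct
  positive lengths, whose total weight is at most 1.\<close>

lemma ex_description: "\<exists>\<tau>. length \<tau> = K U \<sigma> \<and> U \<tau> = Some \<sigma>"
proof -
  define R :: "(nat \<times> bool list) set" where "R = {(l, \<sigma>). l = Suc (string_code \<sigma>)}"
  have "\<exists>M. prefix_free_machine M \<and> (\<forall>l \<sigma>. (l, \<sigma>) \<in> R \<longrightarrow> (\<exists>\<tau>. length \<tau> = Suc l \<and> M \<tau> = Some \<sigma>))"
  proof (rule kraft_chaitin[of "\<lambda>z _. pfst z = Suc (psnd z)"])
    show "recursive_pred (\<lambda>z. pfst (pfst z) = Suc (psnd (pfst z)))"
      by (intro total_recursive_intros)
    fix F assume F: "finite F" "F \<subseteq> R"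
    have "inj_on fst F"
    proof (rule inj_onI)
      fix x y assume "x \<in> F" "y \<in> F" "fst x = fst y"
      moreover have "fst x = Suc (string_code (snd x))" "fst y = Suc (string_code (snd y))"
        using F(2) calculation by (auto simp: R_def)
      ultimately show "x = y" by (simp add: prod_eq_iff)
    qed
    then have "(\<Sum>(l, \<sigma>)\<in>F. (1 / 2 :: real) ^ l) = (\<Sum>l\<in>fst ` F. (1 / 2) ^ l)"
      by (subst sum.reindex) (auto simp: case_prod_beta)
    also have "\<dots> \<le> 2 * (1 / 2) ^ 1"
      using F by (intro sum_half_powers_le) (auto simp: R_def)
    finally show "(\<Sum>(l, \<sigma>)\<in>F. (1 / 2 :: real) ^ l) \<le> 1" by simp
  qed (simp add: R_def)
  then obtain M \<tau> where "prefix_free_machine M" "M \<tau> = Some \<sigma>"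
    unfolding R_def by blast
  then have "\<exists>\<tau>. U \<tau> = Some \<sigma>"
    using universal unfolding universal_prefix_free_machine_def by metis
  then show ?thesis
    unfolding K_def using LeastI_ex[of "\<lambda>l. \<exists>\<tau>. length \<tau> = l \<and> U \<tau> = Some \<sigma>"] by blast
qed

text \<open>Applying \<open>f\<close> to the outputs of \<open>U\<close> leaves the domain
  unchanged, so the new machine is again prefix-free.\<close>

lemma K_recursive_image:
  assumes "total_recursive h" "\<And>\<sigma>. h (string_code \<sigma>) = string_code (f \<sigma>)"
  shows "\<exists>c. \<forall>\<sigma>. K U (f \<sigma>) \<le> K U \<sigma> + c"
proof -
  define M where "M \<tau> = map_option f (U \<tau>)" for \<tau>
  obtain \<phi> where \<phi>: "partial_recursive \<phi>" "\<And>\<sigma>. \<phi> (string_code \<sigma>) = map_option string_code (U \<sigma>)"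
    using prefix_free_U unfolding prefix_free_machine_def recursive_machine_def by blast
  have "partial_recursive (\<lambda>n. Option.bind (\<phi> n) (\<lambda>x. Some (h x)))"
    using assms(1) \<phi>(1) partial_recursive.comp unfolding total_recursive_def by blast
  moreover have "Option.bind (\<phi> (string_code \<sigma>)) (\<lambda>x. Some (h x)) = map_option string_code (M \<sigma>)" for \<sigma>
    by (cases "U \<sigma>") (auto simp: M_def \<phi> assms(2))
  ultimately have "recursive_machine M" unfolding recursive_machine_def by blast
  moreover have "dom M = dom U" by (auto simp: M_def)
  ultimately have "prefix_free_machine M"
    using prefix_free_U unfolding prefix_free_machine_def by simp
  then obtain c where c: "\<forall>\<tau> \<sigma>. M \<tau> = Some \<sigma> \<longrightarrow> K U \<sigma> \<le> length \<tau> + c"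
    using K_le_machine by blast
  have "K U (f \<sigma>) \<le> K U \<sigma> + c" for \<sigma>
  proof -
    obtain \<tau> where "length \<tau> = K U \<sigma>" "U \<tau> = Some \<sigma>" using ex_description by blast
    then show ?thesis using c by (metis M_def option.simps(9))
  qed
  then show ?thesis by blast
qed

end

text \<open>The result has the length \<open>n\<close> of the arguments, not \<open>2 * n\<close>,
  so only about half of each is read. Thus the segments of length \<open>n\<close> of two reals
  yield that of their join, and all three are compared with the same
  \<open>K_nat U n\<close>.\<close>

definition interleave :: "bool list \<Rightarrow> bool list \<Rightarrow> bool list" where
  "interleave \<sigma> \<tau> = map (\<lambda>i. if even i then \<sigma> ! (i div 2) else \<tau> ! (i div 2)) [0..<length \<sigma>]"

lemma string_code_interleave:
  assumes "length \<sigma> = length \<tau>"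
  shows "string_code (interleave \<sigma> \<tau>) = list_encode (map (\<lambda>i. if even i
    then code_nth (string_code \<sigma>) (i div 2) else code_nth (string_code \<tau>) (i div 2)) [0..<length \<sigma>])"
proof -
  have "of_bool (if even i then \<sigma> ! (i div 2) else \<tau> ! (i div 2)) =
      (if even i then code_nth (string_code \<sigma>) (i div 2) else code_nth (string_code \<tau>) (i div 2))"
    if "i < length \<sigma>" for i
  proof -
    have "i div 2 < length \<sigma>" using that by linarith
    then show ?thesis using assms by simp
  qed
  then show ?thesis
    unfolding string_code_def[of "interleave _ _"] unfolding interleave_def map_map
    by (intro arg_cong[of _ _ list_encode] map_cong) auto
qed

section \<open>Finite stages of the universal machine and the coding theorem\<close>

locale approximated_universal_machine = universal_machine +
  fixes F :: "nat \<Rightarrow> nat \<Rightarrow> nat" and \<phi> :: "nat \<Rightarrow> nat option"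
  assumes approx: "stage_approximation F \<phi>"
    and \<phi>: "\<phi> (string_code \<sigma>) = map_option string_code (U \<sigma>)"
begin

text \<open>The bound on the code of \<tau> makes every stage finite.\<close>

definition stage :: "nat \<Rightarrow> bool list set" where
  "stage t = {\<tau>. string_code \<tau> < t \<and> F t (string_code \<tau>) \<noteq> 0}"

text \<open>This is the approximation written \<open>Q t n\<close> in the introduction.\<close>

definition weight :: "nat \<Rightarrow> nat \<Rightarrow> real" where
  "weight t n = (\<Sum>\<tau>\<in>{\<tau>\<in>stage t. length (the (U \<tau>)) = n}. (1 / 2) ^ length \<tau>)"

lemma finite_stage [simp]: "finite (stage t)"
proof (rule finite_imageD[OF _ inj_on_subset[OF inj_string_code]])
  show "finite (string_code ` stage t)"
    by (rule finite_subset[of _ "{..<t}"]) (auto simp: stage_def)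
qed simp

lemma stageD:
  assumes "\<tau> \<in> stage t"
  shows "F t (string_code \<tau>) = Suc (string_code (the (U \<tau>)))" "\<exists>\<sigma>. U \<tau> = Some \<sigma>"
proof -
  obtain y where y: "F t (string_code \<tau>) = Suc y"
    using assms by (auto simp: stage_def gr0_conv_Suc)
  then have "\<phi> (string_code \<tau>) = Some y" using stage_approximationD(3)[OF approx] by blast
  then show "F t (string_code \<tau>) = Suc (string_code (the (U \<tau>)))" "\<exists>\<sigma>. U \<tau> = Some \<sigma>"
    using y by (auto simp: \<phi>)
qed

lemma stage_mono:
  assumes "s \<le> t"
  shows "stage s \<subseteq> stage t"
proof
  fix \<tau> assume "\<tau> \<in> stage s"
  then show "\<tau> \<in> stage t"
    using stage_approximationD(2)[OF approx assms stageD(1)] assms by (simp add: stage_def)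
qed

lemma ex_stage:
  assumes "U \<tau> = Some \<sigma>"
  shows "\<exists>t. \<tau> \<in> stage t"
proof -
  have "\<phi> (string_code \<tau>) = Some (string_code \<sigma>)" by (simp add: \<phi> assms)
  then obtain s where s: "F s (string_code \<tau>) = Suc (string_code \<sigma>)"
    using stage_approximationD(3)[OF approx] by blast
  have "F (s + Suc (string_code \<tau>)) (string_code \<tau>) = Suc (string_code \<sigma>)"
    by (rule stage_approximationD(2)[OF approx _ s]) simp
  then have "\<tau> \<in> stage (s + Suc (string_code \<tau>))" by (simp add: stage_def)
  then show ?thesis by blast
qed

lemma weight_mono: "s \<le> t \<Longrightarrow> weight s n \<le> weight t n"
  unfolding weight_def using stage_mono by (intro sum_mono2) auto

text \<open>Kraft's inequality for the finite prefix-free set \<open>stage t\<close>; outputs of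
  different lengths have different descriptions.\<close>

lemma sum_weight_le:
  assumes "finite N"
  shows "(\<Sum>n\<in>N. weight t n) \<le> 1"
proof -
  have "stage t \<subseteq> dom U" using stageD(2) by auto
  then have "prefix_free (stage t)"
    using prefix_free_U unfolding prefix_free_machine_def prefix_free_def by (meson subsetD)
  then have *: "(\<Sum>\<tau>\<in>stage t. (1 / 2 :: real) ^ length \<tau>) \<le> 1"
    by (rule kraft_inequality) simp
  have "(\<Sum>n\<in>N. weight t n) = (\<Sum>\<tau>\<in>(\<Union>n\<in>N. {\<tau>\<in>stage t. length (the (U \<tau>)) = n}). (1 / 2) ^ length \<tau>)"
    unfolding weight_def using assms by (subst sum.UNION_disjoint) auto
  also have "\<dots> \<le> (\<Sum>\<tau>\<in>stage t. (1 / 2 :: real) ^ length \<tau>)"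
    by (intro sum_mono2) auto
  finally show ?thesis using * by linarith
qed

text \<open>The integer \<open>weight t n * 2 ^ t\<close>, computed from codes. No exponent is
  truncated, because a description in \<open>stage t\<close> is no longer than its code, which is
  below \<open>t\<close>.\<close>

definition scaled_weight :: "nat \<Rightarrow> nat \<Rightarrow> nat" where
  "scaled_weight t n = (\<Sum>c<t. of_bool (is_string_code c \<and> F t c \<noteq> 0 \<and> code_length (F t c - 1) = n)
     * 2 ^ (t - code_length c))"

lemma scaled_weight: "real (scaled_weight t n) = weight t n * 2 ^ t"
proof -
  let ?C = "string_code ` {\<tau>\<in>stage t. length (the (U \<tau>)) = n}"
  have len: "length \<tau> \<le> t" if "\<tau> \<in> stage t" for \<tau>
    using that length_le_string_code[of \<tau>] by (simp add: stage_def)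
  have "scaled_weight t n = (\<Sum>c\<in>?C. 2 ^ (t - code_length c))"
    unfolding scaled_weight_def
  proof (rule sum.mono_neutral_cong_right)
    show "?C \<subseteq> {..<t}" by (auto simp: stage_def)
    show "\<forall>c\<in>{..<t} - ?C. of_bool (is_string_code c \<and> F t c \<noteq> 0 \<and> code_length (F t c - 1) = n)
     * 2 ^ (t - code_length c) = (0 :: nat)"
    proof
      fix c assume c: "c \<in> {..<t} - ?C"
      have "\<not> (is_string_code c \<and> F t c \<noteq> 0 \<and> code_length (F t c - 1) = n)"
      proof
        assume *: "is_string_code c \<and> F t c \<noteq> 0 \<and> code_length (F t c - 1) = n"
        then obtain \<tau> where \<tau>: "c = string_code \<tau>" by blast
        then have "\<tau> \<in> stage t" using c * by (simp add: stage_def)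
        then have "c \<in> ?C" using * stageD(1)[of \<tau> t] \<tau> by auto
        then show False using c by blast
      qed
      then show "of_bool (is_string_code c \<and> F t c \<noteq> 0 \<and> code_length (F t c - 1) = n)
        * 2 ^ (t - code_length c) = (0 :: nat)" by simp
    qed
  qed (auto simp: stageD(1))
  also have "\<dots> = (\<Sum>\<tau>\<in>{\<tau>\<in>stage t. length (the (U \<tau>)) = n}. 2 ^ (t - length \<tau>))"
    by (subst sum.reindex) (auto simp: inj_on_def)
  also have "real \<dots> = weight t n * 2 ^ t"
    unfolding weight_def sum_distrib_right of_nat_sum
    by (intro sum.cong) (auto simp: len power_diff[of "2 :: real"] power_one_over)
  finally show ?thesis .
qed

lemma scaled_weight_iff:
  "2 ^ t \<le> scaled_weight t n * 2 ^ k \<longleftrightarrow> (1 / 2) ^ k \<le> weight t n"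
  "scaled_weight t n * 2 ^ k < 2 * 2 ^ t \<longleftrightarrow> weight t n < 2 * (1 / 2) ^ k"
proof -
  have "2 ^ t \<le> scaled_weight t n * 2 ^ k \<longleftrightarrow> real (2 ^ t) \<le> real (scaled_weight t n * 2 ^ k)"
    by (simp only: of_nat_le_iff)
  also have "\<dots> \<longleftrightarrow> 1 * 2 ^ t \<le> weight t n * 2 ^ k * 2 ^ t"
    by (simp add: scaled_weight ac_simps)
  also have "\<dots> \<longleftrightarrow> 1 \<le> weight t n * 2 ^ k"
    by (rule mult_le_cancel_right_pos) simp
  also have "\<dots> \<longleftrightarrow> (1 / 2) ^ k \<le> weight t n" by (simp add: power_one_over field_simps)
  finally show "2 ^ t \<le> scaled_weight t n * 2 ^ k \<longleftrightarrow> (1 / 2) ^ k \<le> weight t n" .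
  have "scaled_weight t n * 2 ^ k < 2 * 2 ^ t \<longleftrightarrow> real (scaled_weight t n * 2 ^ k) < real (2 * 2 ^ t)"
    by (simp only: of_nat_less_iff)
  also have "\<dots> \<longleftrightarrow> weight t n * 2 ^ k * 2 ^ t < 2 * 2 ^ t"
    by (simp add: scaled_weight ac_simps)
  also have "\<dots> \<longleftrightarrow> weight t n * 2 ^ k < 2"
    by (rule mult_less_cancel_right_pos) simp
  also have "\<dots> \<longleftrightarrow> weight t n < 2 * (1 / 2) ^ k" by (simp add: power_one_over field_simps)
  finally show "scaled_weight t n * 2 ^ k < 2 * 2 ^ t \<longleftrightarrow> weight t n < 2 * (1 / 2) ^ k" .
qed

lemma total_recursive_scaled_weight:
  assumes "total_recursive f" "total_recursive g"
  shows "total_recursive (\<lambda>n. scaled_weight (f n) (g n))"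
  unfolding scaled_weight_def
  by (intro total_recursive_intros recursive_pred_is_string_code total_recursive_code_length
      stage_approximationD(1)[OF approx] total_recursive_comp[OF assms(1)] total_recursive_comp[OF assms(2)]
      assms)

text \<open>Request \<open>replicate n False\<close> at length \<open>Suc k\<close> as soon as the
  weight of \<open>n\<close> reaches \<open>1 / 2 ^ k\<close>. The levels of all \<open>n\<close>
  together weigh at most 2 by \<open>sum_levels_le\<close>, and the successor halves this.\<close>

theorem coding_theorem: "\<exists>c. \<forall>n k t. (1 / 2) ^ k \<le> weight t n \<longrightarrow> K_nat U n \<le> k + c"
proof -
  \<comment> \<open>\<open>pfst z - 1\<close> recovers \<open>k\<close> from the requested length
    \<open>Suc k\<close>; the guard \<open>1 \<le> pfst z\<close> excludes truncation.\<close>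
  define P where "P z t \<longleftrightarrow> 1 \<le> pfst z \<and> (\<forall>i<code_length (psnd z). code_nth (psnd z) i = 0) \<and>
    2 ^ t \<le> scaled_weight t (code_length (psnd z)) * 2 ^ (pfst z - 1)" for z t
  define R where "R = {(Suc k, replicate n False) | k n t. (1 / 2) ^ k \<le> weight t n}"
  have "\<exists>c. \<forall>l \<sigma>. (l, \<sigma>) \<in> R \<longrightarrow> K U \<sigma> \<le> l + c"
  proof (rule K_le_request[of P])
    show "recursive_pred (\<lambda>z. P (pfst z) (psnd z))"
      unfolding P_def by (intro total_recursive_intros total_recursive_code_length
        total_recursive_code_nth total_recursive_scaled_weight)
    fix l \<sigma>
    have "(\<forall>i<length \<sigma>. \<not> \<sigma> ! i) \<longleftrightarrow> \<sigma> = replicate (length \<sigma>) False"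
      by (auto simp: list_eq_iff_nth_eq)
    then have "(\<exists>t. P (prod_encode (l, string_code \<sigma>)) t) \<longleftrightarrow>
      1 \<le> l \<and> \<sigma> = replicate (length \<sigma>) False \<and> (\<exists>t. (1 / 2) ^ (l - 1) \<le> weight t (length \<sigma>))"
      by (auto simp: P_def scaled_weight_iff)
    also have "\<dots> \<longleftrightarrow> (l, \<sigma>) \<in> R"
    proof
      assume *: "1 \<le> l \<and> \<sigma> = replicate (length \<sigma>) False \<and> (\<exists>t. (1 / 2) ^ (l - 1) \<le> weight t (length \<sigma>))"
      then have "l = Suc (l - 1)" by simp
      with * show "(l, \<sigma>) \<in> R" unfolding R_def by blast
    qed (auto simp: R_def)
    finally show "(l, \<sigma>) \<in> R \<longleftrightarrow> (\<exists>t. P (prod_encode (l, string_code \<sigma>)) t)" ..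
  next
    fix F' assume F': "finite F'" "F' \<subseteq> R"
    define f where "f = (\<lambda>(l :: nat, \<sigma> :: bool list). (length \<sigma>, l - 1))"
    have "\<forall>e\<in>F'. \<exists>t. (1 / 2) ^ snd (f e) \<le> weight t (fst (f e))"
      using F'(2) by (fastforce simp: R_def f_def)
    then obtain s where s: "\<forall>e\<in>F'. (1 / 2) ^ snd (f e) \<le> weight (s e) (fst (f e))"
      by metis
    \<comment> \<open>One stage for all the finitely many requests: the sum of their stages is above
      each of them.\<close>
    define T where "T = (\<Sum>e\<in>F'. s e)"
    have T: "\<forall>e\<in>F'. (1 / 2) ^ snd (f e) \<le> weight T (fst (f e))"
      using s weight_mono F'(1) unfolding T_def by (meson member_le_sum order_trans zero_le)
    have "e = (Suc (snd (f e)), replicate (fst (f e)) False)" if "e \<in> F'" for e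
      using that F'(2) by (auto simp: R_def f_def)
    then have inj: "inj_on f F'" by (metis inj_onI)
    have "(\<Sum>(l, \<sigma>)\<in>F'. (1 / 2 :: real) ^ l) = (\<Sum>e\<in>F'. 1 / 2 * (1 / 2) ^ snd (f e))"
      using F'(2) by (intro sum.cong) (auto simp: R_def f_def)
    also have "\<dots> = 1 / 2 * (\<Sum>(n, k)\<in>f ` F'. (1 / 2) ^ k)"
      unfolding sum_distrib_left by (subst sum.reindex[OF inj]) (simp add: case_prod_beta)
    also have "\<dots> \<le> 1 / 2 * 2"
    proof (intro mult_left_mono sum_levels_le)
      fix n k assume "(n, k) \<in> f ` F'"
      then show "(1 / 2) ^ k \<le> weight T n" using T by (metis fst_conv imageE snd_conv)
    qed (use F'(1) sum_weight_le in auto)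
    finally show "(\<Sum>(l, \<sigma>)\<in>F'. (1 / 2 :: real) ^ l) \<le> 1" by simp
  qed
  then obtain c where c: "\<And>l \<sigma>. (l, \<sigma>) \<in> R \<Longrightarrow> K U \<sigma> \<le> l + c" by blast
  have "K_nat U n \<le> k + Suc c" if "(1 / 2) ^ k \<le> weight t n" for n k t
    using c[of "Suc k" "replicate n False"] that unfolding R_def K_nat_def by auto
  then show ?thesis by blast
qed

section \<open>Requests for interleaved pairs\<close>

definition described_by :: "nat \<Rightarrow> nat \<Rightarrow> bool list \<Rightarrow> bool" where
  "described_by t l \<sigma> \<longleftrightarrow> (\<exists>\<tau>\<in>stage t. U \<tau> = Some \<sigma> \<and> length \<tau> \<le> l)"

lemma described_by_mono: "s \<le> t \<Longrightarrow> described_by s l \<sigma> \<Longrightarrow> described_by t l \<sigma>"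
  using stage_mono unfolding described_by_def by blast

lemma described_by_code:
  "described_by t l \<sigma> \<longleftrightarrow> (\<exists>c<t. is_string_code c \<and> F t c = Suc (string_code \<sigma>) \<and> code_length c \<le> l)"
proof
  assume "described_by t l \<sigma>"
  then obtain \<tau> where "\<tau> \<in> stage t" "U \<tau> = Some \<sigma>" "length \<tau> \<le> l" unfolding described_by_def by blast
  then show "\<exists>c<t. is_string_code c \<and> F t c = Suc (string_code \<sigma>) \<and> code_length c \<le> l"
    using stageD(1)[of \<tau> t] by (intro exI[of _ "string_code \<tau>"]) (simp add: stage_def)
next
  assume "\<exists>c<t. is_string_code c \<and> F t c = Suc (string_code \<sigma>) \<and> code_length c \<le> l"
  then obtain \<tau> where "string_code \<tau> < t" "F t (string_code \<tau>) = Suc (string_code \<sigma>)" "length \<tau> \<le> l"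
    by auto
  moreover from this have "\<tau> \<in> stage t" by (simp add: stage_def)
  ultimately show "described_by t l \<sigma>"
    using stageD[of \<tau> t] unfolding described_by_def by fastforce
qed

text \<open>Each such string has a description contributing at least \<open>1 / 2 ^ (k + d)\<close>
  to \<open>weight t n\<close>, and different strings have different descriptions.\<close>

lemma card_described_by:
  assumes "weight t n < 2 * (1 / 2) ^ k"
  shows "finite {\<sigma>. length \<sigma> = n \<and> described_by t (k + d) \<sigma>}"
    and "card {\<sigma>. length \<sigma> = n \<and> described_by t (k + d) \<sigma>} \<le> 2 ^ Suc d"
proof -
  let ?X = "{\<sigma>. length \<sigma> = n \<and> described_by t (k + d) \<sigma>}"
  let ?Y = "{\<tau>\<in>stage t. length (the (U \<tau>)) = n \<and> length \<tau> \<le> k + d}"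
  have X: "?X \<subseteq> (\<lambda>\<tau>. the (U \<tau>)) ` ?Y" by (force simp: described_by_def)
  have fin: "finite ?Y" by simp
  show "finite ?X" using X by (rule finite_subset) simp
  have "card ?X \<le> card ?Y"
    using card_mono[OF _ X] card_image_le[OF fin, of "\<lambda>\<tau>. the (U \<tau>)"] by simp
  have "card ?Y * (1 / 2 :: real) ^ (k + d) = (\<Sum>\<tau>\<in>?Y. (1 / 2) ^ (k + d))" by simp
  also have "\<dots> \<le> (\<Sum>\<tau>\<in>?Y. (1 / 2) ^ length \<tau>)"
    by (intro sum_mono power_decreasing) auto
  also have "\<dots> \<le> weight t n"
    unfolding weight_def by (intro sum_mono2) auto
  also note assms
  finally have "real (card ?Y) < real (2 ^ Suc d)"
    by (simp add: power_add power_one_over field_simps)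
  then have "card ?Y < 2 ^ Suc d" by (simp only: of_nat_less_iff)
  with \<open>card ?X \<le> card ?Y\<close> show "card ?X \<le> 2 ^ Suc d" by linarith
qed

text \<open>The two bounds determine \<open>k\<close> as the level of the weight at stage
  \<open>t\<close>. While the weight grows, the same \<open>n\<close> may pass through several
  levels, each with requests of its own.\<close>

definition pair_request :: "nat \<Rightarrow> nat \<Rightarrow> nat \<Rightarrow> nat \<Rightarrow> bool list \<Rightarrow> bool" where
  "pair_request t n k d \<upsilon> \<longleftrightarrow> (1 / 2) ^ k \<le> weight t n \<and> weight t n < 2 * (1 / 2) ^ k \<and>
     (\<exists>\<sigma> \<tau>. length \<sigma> = n \<and> length \<tau> = n \<and> described_by t (k + d) \<sigma> \<and> described_by t (k + d) \<tau> \<and>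
       \<upsilon> = interleave \<sigma> \<tau>)"

text \<open>The requests may arise at different stages, but by monotonicity all their strings are
  described at the largest of these stages. The pairs available there number at most the square of
  the bound in \<open>card_described_by\<close>.\<close>

lemma card_pair_requests:
  assumes "finite E" "\<And>\<upsilon>. \<upsilon> \<in> E \<Longrightarrow> \<exists>t. pair_request t n k d \<upsilon>"
  shows "card E \<le> 2 ^ (2 * d + 2)"
proof (cases "E = {}")
  case False
  obtain s where s: "\<And>\<upsilon>. \<upsilon> \<in> E \<Longrightarrow> pair_request (s \<upsilon>) n k d \<upsilon>" using assms(2) by metis
  \<comment> \<open>The maximum rather than an arbitrary common bound: the weight must still be
    below \<open>2 * (1 / 2) ^ k\<close> at \<open>T\<close>, and this is known only for the stages
    of the requests.\<close>
  define T where "T = Max (s ` E)"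
  have le: "s \<upsilon> \<le> T" if "\<upsilon> \<in> E" for \<upsilon> unfolding T_def using assms(1) that by simp
  have "T \<in> s ` E" unfolding T_def using assms(1) False by (intro Max_in) auto
  then have "weight T n < 2 * (1 / 2) ^ k" using s by (auto simp: pair_request_def)
  note X = card_described_by[OF this, of d]
  let ?X = "{\<sigma>. length \<sigma> = n \<and> described_by T (k + d) \<sigma>}"
  have "E \<subseteq> (\<lambda>(\<sigma>, \<tau>). interleave \<sigma> \<tau>) ` (?X \<times> ?X)"
  proof
    fix \<upsilon> assume "\<upsilon> \<in> E"
    then show "\<upsilon> \<in> (\<lambda>(\<sigma>, \<tau>). interleave \<sigma> \<tau>) ` (?X \<times> ?X)"
      using s[of \<upsilon>] described_by_mono[OF le] unfolding pair_request_def by blast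
  qed
  then have "card E \<le> card (?X \<times> ?X)"
    using X(1) by (meson card_image_le card_mono finite_SigmaI finite_imageI le_trans)
  also have "\<dots> \<le> 2 ^ Suc d * 2 ^ Suc d"
    unfolding card_cartesian_product by (intro mult_le_mono X(2))
  also have "\<dots> = 2 ^ (Suc d + Suc d)" by (simp only: power_add)
  also have "Suc d + Suc d = 2 * d + 2" by simp
  finally show ?thesis .
qed simp

text \<open>Requests of length \<open>3 * d + k + 4\<close> are affordable: for fixed
  \<open>n\<close>, \<open>k\<close>, \<open>d\<close> there are at most
  \<open>2 ^ (2 * d + 2)\<close> of them, of weight at most
  \<open>(1 / 2) ^ k * (1 / 4 * (1 / 2) ^ d)\<close>. The sums over the levels and over
  \<open>d\<close> are each at most 2, which makes a total of at most 1.\<close>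

lemma K_pair_request: "\<exists>c. \<forall>t n k d \<upsilon>. pair_request t n k d \<upsilon> \<longrightarrow> K U \<upsilon> \<le> 3 * d + k + c"
proof -
  \<comment> \<open>Besides \<open>t\<close>, \<open>k\<close> and \<open>d\<close>, the witnesses
    are the codes \<open>a\<close> and \<open>b\<close> of descriptions of the two strings. The
    strings have the codes \<open>F t a - 1\<close> and \<open>F t b - 1\<close>, and
    \<open>n\<close> is their common length. \<open>P\<close> packs the five witnesses into one
    number.\<close>
  define Q where "Q z t k d a b \<longleftrightarrow> a < t \<and> b < t \<and> is_string_code a \<and> is_string_code b \<and>
    F t a \<noteq> 0 \<and> F t b \<noteq> 0 \<and> code_length a \<le> k + d \<and> code_length b \<le> k + d \<and>
    code_length (F t a - 1) = code_length (F t b - 1) \<and>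
    2 ^ t \<le> scaled_weight t (code_length (F t a - 1)) * 2 ^ k \<and>
    scaled_weight t (code_length (F t a - 1)) * 2 ^ k < 2 * 2 ^ t \<and>
    pfst z = 3 * d + k + 4 \<and>
    psnd z = list_encode (map (\<lambda>i. if even i then code_nth (F t a - 1) (i div 2)
      else code_nth (F t b - 1) (i div 2)) [0..<code_length (F t a - 1)])" for z t k d a b
  define P where "P z w \<longleftrightarrow> Q z (pfst w) (pfst (psnd w)) (pfst (psnd (psnd w)))
    (pfst (psnd (psnd (psnd w)))) (psnd (psnd (psnd (psnd w))))" for z w
  have P: "(\<exists>w. P z w) \<longleftrightarrow> (\<exists>t k d a b. Q z t k d a b)" for z
  proof
    assume "\<exists>t k d a b. Q z t k d a b"
    then obtain t k d a b where "Q z t k d a b" by blast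
    then have "P z (prod_encode (t, prod_encode (k, prod_encode (d, prod_encode (a, b)))))"
      by (simp add: P_def)
    then show "\<exists>w. P z w" by blast
  qed (unfold P_def, blast)
  define R where "R = {(3 * d + k + 4, \<upsilon>) | t n k d \<upsilon>. pair_request t n k d \<upsilon>}"
  have "\<exists>c. \<forall>l \<sigma>. (l, \<sigma>) \<in> R \<longrightarrow> K U \<sigma> \<le> l + c"
  proof (rule K_le_request[of P])
    show "recursive_pred (\<lambda>z. P (pfst z) (psnd z))"
      unfolding P_def Q_def
      by (intro total_recursive_intros total_recursive_code_length total_recursive_code_nth
        total_recursive_map_upt recursive_pred_even recursive_pred_is_string_code
        total_recursive_scaled_weight stage_approximationD(1)[OF approx])
    fix l \<upsilon>
    show "(l, \<upsilon>) \<in> R \<longleftrightarrow> (\<exists>w. P (prod_encode (l, string_code \<upsilon>)) w)"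
      unfolding P
    proof
      assume "(l, \<upsilon>) \<in> R"
      then obtain t n k d \<sigma> \<tau> where l: "l = 3 * d + k + 4"
        and w: "(1 / 2) ^ k \<le> weight t n" "weight t n < 2 * (1 / 2) ^ k"
        and len: "length \<sigma> = n" "length \<tau> = n"
        and "described_by t (k + d) \<sigma>" "described_by t (k + d) \<tau>" and \<upsilon>: "\<upsilon> = interleave \<sigma> \<tau>"
        unfolding R_def pair_request_def by blast
      then obtain a b where "a < t" "is_string_code a" "F t a = Suc (string_code \<sigma>)" "code_length a \<le> k + d"
        and "b < t" "is_string_code b" "F t b = Suc (string_code \<tau>)" "code_length b \<le> k + d"
        unfolding described_by_code by blast
      then have "Q (prod_encode (l, string_code \<upsilon>)) t k d a b"
        using w len l string_code_interleave[of \<sigma> \<tau>] by (simp add: Q_def scaled_weight_iff \<upsilon> cong: if_cong)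
      then show "\<exists>t k d a b. Q (prod_encode (l, string_code \<upsilon>)) t k d a b" by blast
    next
      assume "\<exists>t k d a b. Q (prod_encode (l, string_code \<upsilon>)) t k d a b"
      then obtain t k d a b where Q: "Q (prod_encode (l, string_code \<upsilon>)) t k d a b" by blast
      then obtain \<alpha> \<beta> where ab: "a = string_code \<alpha>" "b = string_code \<beta>" unfolding Q_def by blast
      then have "\<alpha> \<in> stage t" "\<beta> \<in> stage t" using Q by (auto simp: Q_def stage_def)
      then obtain \<sigma> \<tau> where F: "F t a = Suc (string_code \<sigma>)" "F t b = Suc (string_code \<tau>)"
        using stageD(1) ab by blast
      then have len: "length \<tau> = length \<sigma>" using Q by (simp add: Q_def)
      have "described_by t (k + d) \<sigma>" "described_by t (k + d) \<tau>"
        using Q F unfolding described_by_code Q_def by blast+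
      moreover have "string_code \<upsilon> = string_code (interleave \<sigma> \<tau>)"
        using Q F string_code_interleave[OF len[symmetric]] by (simp add: Q_def cong: if_cong)
      ultimately have "pair_request t (length \<sigma>) k d \<upsilon>"
        using Q F len unfolding pair_request_def
        by (auto simp: Q_def scaled_weight_iff)
      moreover have "l = 3 * d + k + 4" using Q by (simp add: Q_def)
      ultimately show "(l, \<upsilon>) \<in> R" unfolding R_def by blast
    qed
  next
    fix E assume E: "finite E" "E \<subseteq> R"
    have "\<forall>e\<in>E. \<exists>s p. fst e = 3 * snd (snd p) + fst (snd p) + 4 \<and>
        pair_request s (fst p) (fst (snd p)) (snd (snd p)) (snd e)"
      using E(2) unfolding R_def by fastforce
    \<comment> \<open>\<open>s e\<close> is a stage and \<open>p e\<close> the triple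
      \<open>(n, k, d)\<close> behind the request \<open>e\<close>.\<close>
    then obtain s p where sp: "\<And>e. e \<in> E \<Longrightarrow> fst e = 3 * snd (snd (p e)) + fst (snd (p e)) + 4"
      "\<And>e. e \<in> E \<Longrightarrow> pair_request (s e) (fst (p e)) (fst (snd (p e))) (snd (snd (p e))) (snd e)"
      by metis
    define T where "T = (\<Sum>e\<in>E. s e)"
    define G where "G = (\<lambda>e. (fst (p e), fst (snd (p e)))) ` E"
    define D where "D = (\<lambda>e. snd (snd (p e))) ` E"
    have G: "(1 / 2) ^ k \<le> weight T n" if "(n, k) \<in> G" for n k
    proof -
      obtain e where e: "e \<in> E" "n = fst (p e)" "k = fst (snd (p e))" using \<open>(n, k) \<in> G\<close> by (auto simp: G_def)
      then have "(1 / 2) ^ k \<le> weight (s e) n" using sp(2) by (auto simp: pair_request_def)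
      also have "\<dots> \<le> weight T n"
        unfolding T_def using E(1) e(1) by (intro weight_mono member_le_sum) auto
      finally show ?thesis .
    qed
    have fiber: "(\<Sum>e\<in>{e\<in>E. p e = q}. (1 / 2 :: real) ^ fst e) \<le> (1 / 2) ^ fst (snd q) * (1 / 4 * (1 / 2) ^ snd (snd q))" for q
    proof -
      obtain n k d where q: "q = (n, k, d)" by (cases q)
      let ?E = "{e\<in>E. p e = q}"
      \<comment> \<open>Within a fiber the requested length is fixed by \<open>q\<close>, so
        different requests have different strings.\<close>
      have inj: "inj_on snd ?E"
        using sp(1) by (auto simp: inj_on_def prod_eq_iff)
      have "card (snd ` ?E) \<le> 2 ^ (2 * d + 2)"
      proof (rule card_pair_requests)
        fix \<upsilon> assume "\<upsilon> \<in> snd ` ?E"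
        then obtain e where "e \<in> E" "p e = q" "\<upsilon> = snd e" by blast
        then show "\<exists>t. pair_request t n k d \<upsilon>" using sp(2)[of e] by (auto simp: q)
      qed (use E(1) in simp)
      then have "card ?E \<le> 2 ^ (2 * d + 2)" by (simp only: card_image[OF inj])
      then have "real (card ?E) \<le> real (2 ^ (2 * d + 2))" by (simp only: of_nat_le_iff)
      then have c: "real (card ?E) \<le> 2 ^ (2 * d + 2)" by simp
      have "(\<Sum>e\<in>?E. (1 / 2 :: real) ^ fst e) = (\<Sum>e\<in>?E. (1 / 2) ^ (3 * d + k + 4))"
        using sp(1) q by (intro sum.cong) auto
      also have "\<dots> = card ?E * (1 / 2) ^ (3 * d + k + 4)" by simp
      also have "\<dots> \<le> 2 ^ (2 * d + 2) * (1 / 2) ^ (3 * d + k + 4)"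
        by (intro mult_right_mono c) simp
      also have "\<dots> = (1 / 2) ^ k * (1 / 4 * (1 / 2) ^ d)"
      proof -
        have "(3 * d + k + 4) = (2 * d + 2) + (k + (2 + d))" by simp
        then have "(1 / 2 :: real) ^ (3 * d + k + 4) = (1 / 2) ^ (2 * d + 2) * ((1 / 2) ^ k * ((1 / 2) ^ 2 * (1 / 2) ^ d))"
          by (simp only: power_add)
        then have "(2 :: real) ^ (2 * d + 2) * (1 / 2) ^ (3 * d + k + 4) =
            (2 * (1 / 2)) ^ (2 * d + 2) * ((1 / 2) ^ k * ((1 / 2) ^ 2 * (1 / 2) ^ d))"
          by (simp only: power_mult_distrib mult.assoc)
        then show ?thesis by (simp add: power2_eq_square)
      qed
      finally show ?thesis by (simp add: q)
    qed
    let ?h = "\<lambda>(n :: nat, k :: nat, d :: nat). ((n, k), d)"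
    have inj: "inj_on ?h (p ` E)" by (auto simp: inj_on_def split: prod.splits)
    have "(\<Sum>(l, \<sigma>)\<in>E. (1 / 2 :: real) ^ l) = (\<Sum>e\<in>E. (1 / 2) ^ fst e)"
      by (simp add: case_prod_beta)
    also have "\<dots> = (\<Sum>q\<in>p ` E. \<Sum>e\<in>{e\<in>E. p e = q}. (1 / 2) ^ fst e)"
      using E(1) by (rule sum.image_gen)
    also have "\<dots> \<le> (\<Sum>q\<in>p ` E. (1 / 2) ^ fst (snd q) * (1 / 4 * (1 / 2) ^ snd (snd q)))"
      by (intro sum_mono fiber)
    also have "\<dots> = (\<Sum>((n, k), d)\<in>?h ` p ` E. (1 / 2) ^ k * (1 / 4 * (1 / 2) ^ d))"
      by (subst sum.reindex[OF inj]) (simp add: case_prod_beta)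
    \<comment> \<open>Enlarging the index set to a product splits the sum into a sum over levels and
      a geometric sum over \<open>d\<close>.\<close>
    also have "\<dots> \<le> (\<Sum>((n, k), d)\<in>G \<times> D. (1 / 2) ^ k * (1 / 4 * (1 / 2) ^ d))"
    proof (rule sum_mono2)
      show "finite (G \<times> D)" using E(1) by (simp add: G_def D_def)
      show "?h ` p ` E \<subseteq> G \<times> D" by (auto simp: G_def D_def case_prod_beta)
    qed (simp add: case_prod_beta)
    also have "\<dots> = (\<Sum>(n, k)\<in>G. (1 / 2) ^ k) * (1 / 4 * (\<Sum>d\<in>D. (1 / 2) ^ d))"
      unfolding sum_distrib_left[of "1 / 4"] sum_product sum.cartesian_product by (simp add: case_prod_beta)
    also have "\<dots> \<le> 2 * (1 / 4 * (2 * (1 / 2) ^ 0))"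
    proof (intro mult_mono sum_half_powers_le mult_left_mono)
      show "(\<Sum>(n, k)\<in>G. (1 / 2 :: real) ^ k) \<le> 2"
      proof (rule sum_levels_le)
        show "finite G" using E(1) by (simp add: G_def)
      qed (use G sum_weight_le in auto)
    qed (use E(1) in \<open>auto simp: D_def intro!: sum_nonneg\<close>)
    finally show "(\<Sum>(l, \<sigma>)\<in>E. (1 / 2 :: real) ^ l) \<le> 1" by simp
  qed
  then obtain c where c: "\<And>l \<sigma>. (l, \<sigma>) \<in> R \<Longrightarrow> K U \<sigma> \<le> l + c" by blast
  have "K U \<upsilon> \<le> 3 * d + k + (4 + c)" if "pair_request t n k d \<upsilon>" for t n k d \<upsilon>
    using c[of "3 * d + k + 4" \<upsilon>] that unfolding R_def by fastforce
  then show ?thesis by blast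
qed

text \<open>At a stage that shows shortest descriptions of both strings and of
  \<open>replicate n False\<close>, the level \<open>k\<close> of the weight satisfies
  \<open>k \<le> K_nat U n\<close> and, by the coding theorem, \<open>K_nat U n \<le> k + a\<close>.
  Hence both strings are described within \<open>k + (d + a)\<close>, and a request with
  \<open>d + a\<close> for \<open>d\<close> yields the constant \<open>3 * a + b\<close>.\<close>

theorem K_interleave_le:
  "\<exists>c. \<forall>n d \<sigma> \<tau>. length \<sigma> = n \<longrightarrow> length \<tau> = n \<longrightarrow> K U \<sigma> \<le> K_nat U n + d \<longrightarrow> K U \<tau> \<le> K_nat U n + d \<longrightarrow>
     K U (interleave \<sigma> \<tau>) \<le> K_nat U n + 3 * d + c"
proof -
  obtain a where a: "\<And>n k t. (1 / 2) ^ k \<le> weight t n \<Longrightarrow> K_nat U n \<le> k + a"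
    using coding_theorem by blast
  obtain b where b: "\<And>t n k d \<upsilon>. pair_request t n k d \<upsilon> \<Longrightarrow> K U \<upsilon> \<le> 3 * d + k + b"
    using K_pair_request by blast
  have "K U (interleave \<sigma> \<tau>) \<le> K_nat U n + 3 * d + (3 * a + b)"
    if len: "length \<sigma> = n" "length \<tau> = n" and le: "K U \<sigma> \<le> K_nat U n + d" "K U \<tau> \<le> K_nat U n + d" for n d \<sigma> \<tau>
  proof -
    obtain \<alpha> \<beta> \<gamma> where \<alpha>: "length \<alpha> = K U \<sigma>" "U \<alpha> = Some \<sigma>" and \<beta>: "length \<beta> = K U \<tau>" "U \<beta> = Some \<tau>"
      and \<gamma>: "length \<gamma> = K_nat U n" "U \<gamma> = Some (replicate n False)"
      unfolding K_nat_def using ex_description by metis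
    obtain r s t where "\<alpha> \<in> stage r" "\<beta> \<in> stage s" "\<gamma> \<in> stage t" using \<alpha> \<beta> \<gamma> ex_stage by metis
    define T where "T = r + s + t"
    have stage: "\<alpha> \<in> stage T" "\<beta> \<in> stage T" "\<gamma> \<in> stage T"
      using \<open>\<alpha> \<in> stage r\<close> \<open>\<beta> \<in> stage s\<close> \<open>\<gamma> \<in> stage t\<close> stage_mono[of r T] stage_mono[of s T] stage_mono[of t T]
      by (auto simp: T_def)
    have "(1 / 2) ^ length \<gamma> \<le> weight T n"
      unfolding weight_def using stage(3) \<gamma>
      by (intro member_le_sum[of \<gamma> _ "\<lambda>\<tau>. (1 / 2) ^ length \<tau>"]) auto
    then have w: "(1 / 2) ^ K_nat U n \<le> weight T n" by (simp add: \<gamma>)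
    define k where "k = (LEAST k. (1 / 2) ^ k \<le> weight T n)"
    have k: "(1 / 2) ^ k \<le> weight T n" "k \<le> K_nat U n"
      unfolding k_def using w by (rule LeastI Least_le)+
    \<comment> \<open>Minimality of \<open>k\<close> gives the upper bound on the weight; for
      \<open>k = 0\<close> it comes from \<open>weight T n \<le> 1\<close>.\<close>
    have k': "weight T n < 2 * (1 / 2) ^ k"
    proof (cases k)
      case 0
      then show ?thesis using sum_weight_le[of "{n}" T] by simp
    next
      case (Suc j)
      then have "\<not> (1 / 2) ^ j \<le> weight T n" unfolding k_def by (metis lessI not_less_Least)
      then show ?thesis by (simp add: Suc)
    qed
    have "K_nat U n \<le> k + a" using a k(1) by blast
    then have "described_by T (k + (d + a)) \<sigma>" "described_by T (k + (d + a)) \<tau>"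
      using stage le \<alpha> \<beta> unfolding described_by_def by fastforce+
    then have "pair_request T n k (d + a) (interleave \<sigma> \<tau>)"
      unfolding pair_request_def using k k' len by blast
    from b[OF this] k(2) show ?thesis by simp
  qed
  then show ?thesis by blast
qed

end

lemma ex_approximated_universal_machine:
  assumes "universal_prefix_free_machine U"
  shows "\<exists>F \<phi>. approximated_universal_machine U F \<phi>"
proof -
  interpret universal_machine U by unfold_locales (rule assms)
  obtain \<phi> where \<phi>: "partial_recursive \<phi>" "\<forall>\<sigma>. \<phi> (string_code \<sigma>) = map_option string_code (U \<sigma>)"
    using prefix_free_U unfolding prefix_free_machine_def recursive_machine_def by blast
  moreover obtain F where "stage_approximation F \<phi>"
    using partial_recursive_stage_approximation[OF \<phi>(1)] by blast
  ultimately have "approximated_universal_machine U F \<phi>" by unfold_locales auto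
  then show ?thesis by blast
qed

section \<open>Closure properties of the arithmetical classes\<close>

lemma recursive_set_iff: "recursive_set X \<longleftrightarrow> recursive_pred (\<lambda>n. n \<in> X)"
  by (simp add: recursive_set_def total_recursive_def of_bool_def)

lemma Sigma02_set_iff:
  "Sigma02_set X \<longleftrightarrow> (\<exists>P. recursive_pred (\<lambda>z. P (pfst z) (pfst (psnd z)) (psnd (psnd z))) \<and>
     (\<forall>n. n \<in> X \<longleftrightarrow> (\<exists>x. \<forall>y. P n x y)))"
proof
  assume "Sigma02_set X"
  then obtain R where R: "recursive_set R" "\<forall>n. n \<in> X \<longleftrightarrow> (\<exists>x. \<forall>y. prod_encode (n, prod_encode (x, y)) \<in> R)"
    unfolding Sigma02_set_def by blast
  then show "\<exists>P. recursive_pred (\<lambda>z. P (pfst z) (pfst (psnd z)) (psnd (psnd z))) \<and>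
     (\<forall>n. n \<in> X \<longleftrightarrow> (\<exists>x. \<forall>y. P n x y))"
    by (intro exI[of _ "\<lambda>n x y. prod_encode (n, prod_encode (x, y)) \<in> R"]) (simp add: recursive_set_iff)
next
  assume "\<exists>P. recursive_pred (\<lambda>z. P (pfst z) (pfst (psnd z)) (psnd (psnd z))) \<and>
     (\<forall>n. n \<in> X \<longleftrightarrow> (\<exists>x. \<forall>y. P n x y))"
  then obtain P where "recursive_pred (\<lambda>z. P (pfst z) (pfst (psnd z)) (psnd (psnd z)))"
    "\<forall>n. n \<in> X \<longleftrightarrow> (\<exists>x. \<forall>y. P n x y)" by blast
  then show "Sigma02_set X"
    unfolding Sigma02_set_def recursive_set_iff
    by (intro exI[of _ "{z. P (pfst z) (pfst (psnd z)) (psnd (psnd z))}"]) simp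
qed

lemma Pi02_set_iff:
  "Pi02_set X \<longleftrightarrow> Sigma02_set (- X)"
proof
  assume "Pi02_set X"
  then obtain R where "recursive_set R" "\<forall>n. n \<in> X \<longleftrightarrow> (\<forall>x. \<exists>y. prod_encode (n, prod_encode (x, y)) \<in> R)"
    unfolding Pi02_set_def by blast
  then show "Sigma02_set (- X)"
    unfolding Sigma02_set_def recursive_set_iff
    by (intro exI[of _ "- R"]) (simp add: recursive_pred_not)
next
  assume "Sigma02_set (- X)"
  then obtain R where "recursive_set R" "\<forall>n. n \<in> - X \<longleftrightarrow> (\<exists>x. \<forall>y. prod_encode (n, prod_encode (x, y)) \<in> R)"
    unfolding Sigma02_set_def by blast
  then show "Pi02_set X"
    unfolding Pi02_set_def recursive_set_iff
    by (intro exI[of _ "- R"]) (simp add: recursive_pred_not, blast)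
qed

lemma Sigma02_set_vimage:
  assumes "Sigma02_set X" "total_recursive f"
  shows "Sigma02_set (f -` X)"
proof -
  obtain P where P: "recursive_pred (\<lambda>z. P (pfst z) (pfst (psnd z)) (psnd (psnd z)))"
    "\<forall>n. n \<in> X \<longleftrightarrow> (\<exists>x. \<forall>y. P n x y)" using assms(1) unfolding Sigma02_set_iff by blast
  have "recursive_pred (\<lambda>z. P (f (pfst z)) (pfst (psnd z)) (psnd (psnd z)))"
    using total_recursive_comp[OF P(1), of "\<lambda>z. prod_encode (f (pfst z), psnd z)"]
      total_recursive_pair[OF total_recursive_comp[OF assms(2) total_recursive_pfst0] total_recursive_psnd0]
    by simp
  then show ?thesis unfolding Sigma02_set_iff using P(2)
    by (intro exI[of _ "\<lambda>n x y. P (f n) x y"]) simp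
qed

lemma Sigma02_set_Un:
  assumes "Sigma02_set X" "Sigma02_set Y"
  shows "Sigma02_set (X \<union> Y)"
proof -
  obtain P where P: "recursive_pred (\<lambda>z. P (pfst z) (pfst (psnd z)) (psnd (psnd z)))"
    "\<forall>n. n \<in> X \<longleftrightarrow> (\<exists>x. \<forall>y. P n x y)" using assms(1) unfolding Sigma02_set_iff by blast
  obtain Q where Q: "recursive_pred (\<lambda>z. Q (pfst z) (pfst (psnd z)) (psnd (psnd z)))"
    "\<forall>n. n \<in> Y \<longleftrightarrow> (\<exists>x. \<forall>y. Q n x y)" using assms(2) unfolding Sigma02_set_iff by blast
  \<comment> \<open>The first component of the witness selects one of the two sets, so that both
    share one quantifier prefix.\<close>
  let ?P = "\<lambda>n x y. (pfst x = 0 \<and> P n (psnd x) y) \<or> (pfst x \<noteq> 0 \<and> Q n (psnd x) y)"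
  let ?f = "\<lambda>z. prod_encode (pfst z, prod_encode (psnd (pfst (psnd z)), psnd (psnd z)))"
  have f: "total_recursive ?f" by (intro total_recursive_intros)
  have "recursive_pred (\<lambda>z. P (pfst z) (psnd (pfst (psnd z))) (psnd (psnd z)))"
    "recursive_pred (\<lambda>z. Q (pfst z) (psnd (pfst (psnd z))) (psnd (psnd z)))"
    using total_recursive_comp[OF P(1) f] total_recursive_comp[OF Q(1) f] by simp_all
  then have "recursive_pred (\<lambda>z. ?P (pfst z) (pfst (psnd z)) (psnd (psnd z)))"
    by (intro total_recursive_intros)
  moreover have "n \<in> X \<union> Y \<longleftrightarrow> (\<exists>x. \<forall>y. ?P n x y)" for n
  proof
    assume "n \<in> X \<union> Y"
    then consider x where "\<forall>y. P n x y" | x where "\<forall>y. Q n x y" using P(2) Q(2) by blast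
    then show "\<exists>x. \<forall>y. ?P n x y"
    proof cases
      case 1 then show ?thesis by (intro exI[of _ "prod_encode (0, x)"]) simp
    next
      case 2 then show ?thesis by (intro exI[of _ "prod_encode (1, x)"]) simp
    qed
  next
    assume "\<exists>x. \<forall>y. ?P n x y"
    then show "n \<in> X \<union> Y" using P(2) Q(2) by blast
  qed
  ultimately show ?thesis unfolding Sigma02_set_iff by (intro exI[of _ ?P]) simp
qed

lemma Sigma02_set_Int:
  assumes "Sigma02_set X" "Sigma02_set Y"
  shows "Sigma02_set (X \<inter> Y)"
proof -
  obtain P where P: "recursive_pred (\<lambda>z. P (pfst z) (pfst (psnd z)) (psnd (psnd z)))"
    "\<forall>n. n \<in> X \<longleftrightarrow> (\<exists>x. \<forall>y. P n x y)" using assms(1) unfolding Sigma02_set_iff by blast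
  obtain Q where Q: "recursive_pred (\<lambda>z. Q (pfst z) (pfst (psnd z)) (psnd (psnd z)))"
    "\<forall>n. n \<in> Y \<longleftrightarrow> (\<exists>x. \<forall>y. Q n x y)" using assms(2) unfolding Sigma02_set_iff by blast
  \<comment> \<open>The witness is a pair of witnesses, and the two universal quantifiers merge into
    one.\<close>
  let ?P = "\<lambda>n x y. P n (pfst x) y \<and> Q n (psnd x) y"
  have "total_recursive (\<lambda>z. prod_encode (pfst z, prod_encode (pfst (pfst (psnd z)), psnd (psnd z))))"
    "total_recursive (\<lambda>z. prod_encode (pfst z, prod_encode (psnd (pfst (psnd z)), psnd (psnd z))))"
    by (intro total_recursive_intros)+
  from total_recursive_comp[OF P(1) this(1)] total_recursive_comp[OF Q(1) this(2)]
  have "recursive_pred (\<lambda>z. P (pfst z) (pfst (pfst (psnd z))) (psnd (psnd z)))"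
    "recursive_pred (\<lambda>z. Q (pfst z) (psnd (pfst (psnd z))) (psnd (psnd z)))"
    by simp_all
  then have "recursive_pred (\<lambda>z. ?P (pfst z) (pfst (psnd z)) (psnd (psnd z)))"
    by (intro total_recursive_intros)
  moreover have "n \<in> X \<inter> Y \<longleftrightarrow> (\<exists>x. \<forall>y. ?P n x y)" for n
  proof
    assume "n \<in> X \<inter> Y"
    then obtain x x' where "\<forall>y. P n x y" "\<forall>y. Q n x' y" using P(2) Q(2) by blast
    then show "\<exists>x. \<forall>y. ?P n x y" by (intro exI[of _ "prod_encode (x, x')"]) simp
  next
    assume "\<exists>x. \<forall>y. ?P n x y"
    then show "n \<in> X \<inter> Y" using P(2) Q(2) by blast
  qed
  ultimately show ?thesis unfolding Sigma02_set_iff by (intro exI[of _ ?P]) simp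
qed

lemma Delta02_set_vimage:
  "Delta02_set X \<Longrightarrow> total_recursive f \<Longrightarrow> Delta02_set (f -` X)"
  unfolding Delta02_set_def Pi02_set_iff by (auto simp: vimage_Compl[symmetric] intro: Sigma02_set_vimage)

lemma Delta02_set_Un:
  "Delta02_set X \<Longrightarrow> Delta02_set Y \<Longrightarrow> Delta02_set (X \<union> Y)"
  unfolding Delta02_set_def Pi02_set_iff by (simp add: Sigma02_set_Un Sigma02_set_Int)

lemma in_graph_iff: "z \<in> range (\<lambda>n. prod_encode (n, g n)) \<longleftrightarrow> g (pfst z) = psnd z"
proof
  assume "g (pfst z) = psnd z"
  then have "z = prod_encode (pfst z, g (pfst z))" by simp
  then show "z \<in> range (\<lambda>n. prod_encode (n, g n))" by (rule range_eqI)
qed auto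

lemma Delta02_fun_comp:
  assumes "Delta02_fun g" "total_recursive f"
  shows "Delta02_fun (\<lambda>n. g (f n))"
proof -
  have "range (\<lambda>n. prod_encode (n, g (f n))) =
      (\<lambda>z. prod_encode (f (pfst z), psnd z)) -` range (\<lambda>n. prod_encode (n, g n))"
    by (intro set_eqI) (simp only: in_graph_iff vimage_eq prod_encode_inverse fst_conv snd_conv)
  moreover have "total_recursive (\<lambda>z. prod_encode (f (pfst z), psnd z))"
    by (intro total_recursive_intros total_recursive_comp[OF assms(2)])
  ultimately show ?thesis using assms(1) Delta02_set_vimage unfolding Delta02_fun_def by simp
qed

text \<open>A quotient by 3 has only three possible dividends, so the graph is a union of three
  recursive preimages of the graph of \<open>g\<close>.\<close>

lemma Delta02_fun_div3:
  assumes "Delta02_fun g"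
  shows "Delta02_fun (\<lambda>n. g n div 3)"
proof -
  let ?G = "range (\<lambda>n. prod_encode (n, g n))"
  let ?f = "\<lambda>i z. prod_encode (pfst z, 3 * psnd z + i)"
  have "x div 3 = y \<longleftrightarrow> x = 3 * y + 0 \<or> x = 3 * y + 1 \<or> x = 3 * y + 2" for x y :: nat
    by presburger
  then have "range (\<lambda>n. prod_encode (n, g n div 3)) = ?f 0 -` ?G \<union> (?f 1 -` ?G \<union> ?f 2 -` ?G)"
    by (intro set_eqI) (simp only: in_graph_iff vimage_eq Un_iff prod_encode_inverse fst_conv snd_conv)
  moreover have "total_recursive (?f i)" for i by (intro total_recursive_intros)
  ultimately show ?thesis
    using assms Delta02_set_vimage Delta02_set_Un unfolding Delta02_fun_def by presburger
qed

lemma order_fun_div3: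
  assumes "order_fun g"
  shows "order_fun (\<lambda>n. g n div 3)"
  unfolding order_fun_def
proof (intro conjI allI)
  show "mono (\<lambda>n. g n div 3)"
    using assms unfolding order_fun_def by (auto simp: mono_def div_le_mono)
  fix b
  obtain n where "3 * b + 3 < g n" using assms unfolding order_fun_def by blast
  then have "b < g n div 3" by linarith
  then show "\<exists>n. b < g n div 3" by blast
qed

lemma order_fun_half:
  assumes "order_fun g"
  shows "order_fun (\<lambda>n. g (n div 2))"
  unfolding order_fun_def
proof (intro conjI allI)
  show "mono (\<lambda>n. g (n div 2))"
    using assms unfolding order_fun_def by (auto simp: mono_def div_le_mono)
  fix b
  obtain n where "b < g n" using assms unfolding order_fun_def by blast
  then have "b < g (2 * n div 2)" by simp
  then show "\<exists>n. b < g (n div 2)" by blast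
qed

section \<open>Effective joins\<close>

lemma length_initial_segment [simp]: "length (initial_segment A n) = n"
  by (simp add: initial_segment_def)

lemma initial_segment_effective_join:
  "initial_segment (effective_join A B) n = interleave (initial_segment A n) (initial_segment B n)"
proof (rule nth_equalityI)
  fix i assume "i < length (initial_segment (effective_join A B) n)"
  then have "i < n" "i div 2 < n" by auto
  then show "initial_segment (effective_join A B) n ! i =
    interleave (initial_segment A n) (initial_segment B n) ! i"
    by (simp add: initial_segment_def interleave_def effective_join_def)
qed (simp add: interleave_def)

text \<open>The bounds test mirrors the default 0 of \<open>code_nth\<close>, so that the
  computation on codes in \<open>K_every_other_bit\<close> is correct for every
  \<open>j\<close>.\<close>

definition every_other_bit :: "nat \<Rightarrow> bool list \<Rightarrow> bool list" where
  "every_other_bit j \<sigma> = map (\<lambda>i. 2 * i + j < length \<sigma> \<and> \<sigma> ! (2 * i + j)) [0..<length \<sigma> div 2]"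

lemma every_other_bit_effective_join:
  "every_other_bit 0 (initial_segment (effective_join A B) (2 * n)) = initial_segment A n"
  "every_other_bit 1 (initial_segment (effective_join A B) (2 * n)) = initial_segment B n"
  by (auto intro!: nth_equalityI simp: every_other_bit_def initial_segment_def effective_join_def)

context universal_machine
begin

lemma K_every_other_bit: "\<exists>c. \<forall>\<sigma>. K U (every_other_bit j \<sigma>) \<le> K U \<sigma> + c"
proof (rule K_recursive_image)
  show "total_recursive (\<lambda>n. list_encode (map (\<lambda>i. code_nth n (2 * i + j)) [0..<code_length n div 2]))"
    by (intro total_recursive_intros total_recursive_map_upt total_recursive_code_nth total_recursive_code_length)
  show "list_encode (map (\<lambda>i. code_nth (string_code \<sigma>) (2 * i + j)) [0..<code_length (string_code \<sigma>) div 2]) =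
    string_code (every_other_bit j \<sigma>)" for \<sigma>
    unfolding string_code_def[of "every_other_bit _ _"] unfolding every_other_bit_def
    by (simp add: list_encode_eq)
qed

lemma K_nat_double: "\<exists>c. \<forall>n. K_nat U (2 * n) \<le> K_nat U n + c"
proof -
  have "\<exists>c. \<forall>\<sigma>. K U (replicate (2 * length \<sigma>) False) \<le> K U \<sigma> + c"
  proof (rule K_recursive_image)
    show "total_recursive (\<lambda>n. list_encode (map (\<lambda>_. 0) [0..<2 * code_length n]))"
      by (intro total_recursive_intros total_recursive_map_upt total_recursive_code_length)
    show "list_encode (map (\<lambda>_. 0) [0..<2 * code_length (string_code \<sigma>)]) =
      string_code (replicate (2 * length \<sigma>) False)" for \<sigma>
      by (simp add: string_code_def[of "replicate _ _"] map_replicate_const)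
  qed
  then obtain c where "\<And>\<sigma>. K U (replicate (2 * length \<sigma>) False) \<le> K U \<sigma> + c" by blast
  from this[of "replicate n False" for n] show ?thesis unfolding K_nat_def by auto
qed

text \<open>The hypothesis on \<open>J\<close> is applied to the order \<open>g (n div 2)\<close>,
  whose value at length \<open>2 * n\<close> is \<open>g n\<close>. Passing from \<open>J\<close> to
  \<open>A\<close> and from \<open>K_nat U (2 * n)\<close> to \<open>K_nat U n\<close> costs only
  constants.\<close>

lemma KT_Delta02_every_other_bit:
  assumes J: "J \<in> KT_Delta02 U" and A: "\<And>n. initial_segment A n = every_other_bit j (initial_segment J (2 * n))"
  shows "A \<in> KT_Delta02 U"
  unfolding KT_Delta02_def
proof (rule INT_I)
  fix g assume g: "g \<in> {g. order_fun g \<and> Delta02_fun g}"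
  have "total_recursive (\<lambda>n. n div 2)" by (intro total_recursive_intros)
  then have "order_fun (\<lambda>n. g (n div 2))" "Delta02_fun (\<lambda>n. g (n div 2))"
    using g by (auto intro: order_fun_half Delta02_fun_comp)
  with J have "J \<in> KT U (\<lambda>n. g (n div 2))" unfolding KT_Delta02_def by blast
  then obtain a where a: "\<And>n. K U (initial_segment J n) \<le> K_nat U n + g (n div 2) + a"
    unfolding KT_def by blast
  obtain b where b: "\<And>\<sigma>. K U (every_other_bit j \<sigma>) \<le> K U \<sigma> + b" using K_every_other_bit by blast
  obtain c where c: "\<And>n. K_nat U (2 * n) \<le> K_nat U n + c" using K_nat_double by blast
  have "K U (initial_segment A n) \<le> K_nat U n + g n + (a + b + c)" for n
    using a[of "2 * n"] b[of "initial_segment J (2 * n)"] c[of n] by (simp add: A)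
  then show "A \<in> KT U g" unfolding KT_def by blast
qed

end

text \<open>\<open>K_interleave_le\<close> triples the excess over \<open>K_nat U n\<close>, so the
  hypotheses are applied to the order \<open>g n div 3\<close>.\<close>

lemma (in approximated_universal_machine) KT_Delta02_effective_join:
  assumes A: "A \<in> KT_Delta02 U" and B: "B \<in> KT_Delta02 U"
  shows "effective_join A B \<in> KT_Delta02 U"
  unfolding KT_Delta02_def
proof (rule INT_I)
  fix g assume g: "g \<in> {g. order_fun g \<and> Delta02_fun g}"
  then have "order_fun (\<lambda>n. g n div 3)" "Delta02_fun (\<lambda>n. g n div 3)"
    by (simp_all add: order_fun_div3 Delta02_fun_div3)
  with A B have "A \<in> KT U (\<lambda>n. g n div 3)" "B \<in> KT U (\<lambda>n. g n div 3)" unfolding KT_Delta02_def by blast+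
  then obtain a b where a: "\<And>n. K U (initial_segment A n) \<le> K_nat U n + g n div 3 + a"
    and b: "\<And>n. K U (initial_segment B n) \<le> K_nat U n + g n div 3 + b"
    unfolding KT_def by blast
  obtain c where c: "\<And>n d \<sigma> \<tau>. length \<sigma> = n \<Longrightarrow> length \<tau> = n \<Longrightarrow> K U \<sigma> \<le> K_nat U n + d \<Longrightarrow>
      K U \<tau> \<le> K_nat U n + d \<Longrightarrow> K U (interleave \<sigma> \<tau>) \<le> K_nat U n + 3 * d + c"
    using K_interleave_le by blast
  have "K U (initial_segment (effective_join A B) n) \<le> K_nat U n + g n + (3 * (a + b) + c)" for n
  proof -
    \<comment> \<open>The sum \<open>a + b\<close> serves as a common constant, since
      \<open>K_interleave_le\<close> takes the same \<open>d\<close> for both segments.\<close>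
    have "K U (initial_segment (effective_join A B) n) \<le> K_nat U n + 3 * (g n div 3 + (a + b)) + c"
      unfolding initial_segment_effective_join using a[of n] b[of n] by (intro c) auto
    also have "\<dots> = K_nat U n + 3 * (g n div 3) + (3 * (a + b) + c)"
      by (simp only: add_mult_distrib2 add.assoc add.commute add.left_commute)
    also have "\<dots> \<le> K_nat U n + g n + (3 * (a + b) + c)"
      by (intro add_mono order_refl) simp
    finally show ?thesis .
  qed
  then show "effective_join A B \<in> KT U g" unfolding KT_def by blast
qed

theorem theorem3p2:
  fixes U :: machine and A B :: cantor_real
  assumes "universal_prefix_free_machine U"
  shows "A \<in> KT_Delta02 U \<and> B \<in> KT_Delta02 U \<longleftrightarrow> effective_join A B \<in> KT_Delta02 U"
proof -
  obtain F \<phi> where "approximated_universal_machine U F \<phi>"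
    using ex_approximated_universal_machine[OF assms] by blast
  then interpret approximated_universal_machine U F \<phi> .
  show ?thesis
    using KT_Delta02_effective_join KT_Delta02_every_other_bit every_other_bit_effective_join by metis
qed

end
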